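(* Let $\mathbb{K}$ be a field and let $A,B\in\mathbb{K}^{r\times r}$ be similar matrices. Then the eigenschemes $Z_A,Z_B\subseteq\mathbb{P}^{r-1}$ differ only by an automorphism of $\mathbb{P}^{r-1}$, i.e. there is an automorphism $\varphi$ of $\mathbb{P}^{r-1}$ with $\varphi(Z_B)=Z_A$ as closed subschemes.
   Context: For $A\in\mathbb{K}^{r\times r}$, let $\boldsymbol{x}=(x_1,\dots,x_r)^T$ be the column vector of variables of $\mathbb{K}[x_1,\dots,x_r]$ and let $I_A$ be the homogeneous ideal generated by the $2\times2$ minors of the $r\times2$ matrix $(A\boldsymbol{x}\mid\boldsymbol{x})$ with columns $A\boldsymbol{x}$ and $\boldsymbol{x}$. The eigenscheme $Z_A$ of $A$ is the closed subscheme of $\mathbb{P}^{r-1}$ defined by $I_A$. *)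

theory Defs
  imports
    "HOL-Analysis.Analysis"
    "HOL-Algebra.QuotRing"
    "HOL-Library.Poly_Mapping"
begin

section \<open>Ringed spaces over a field and their morphisms\<close>

text \<open>
  Sections are elements of a fixed type; \<open>sections X U\<close> is the ring of sections and is only
  meaningful for open \<open>U\<close>. The structure map to the base field is given by its effect
  \<open>scalar X\<close> on global sections.
\<close>

record ('p, 's, 'k) ringed_space =
  top_of :: "'p topology"
  sections :: "'p set \<Rightarrow> 's ring"
  restr :: "'p set \<Rightarrow> 'p set \<Rightarrow> 's \<Rightarrow> 's"
  scalar :: "'k \<Rightarrow> 's"

text \<open>
  For a morphism \<open>f\<close> from \<open>X\<close> to \<open>Y\<close>, \<open>comap f V\<close> is the map from the sections of \<open>Y\<close> over \<open>V\<close>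
  to the sections of \<open>X\<close> over the preimage of \<open>V\<close>.
\<close>

record ('p, 's, 'q, 't) rs_map =
  pt :: "'p \<Rightarrow> 'q"
  comap :: "'q set \<Rightarrow> 't \<Rightarrow> 's"

definition preim ::
  "('p, 's, 'k) ringed_space \<Rightarrow> ('p, 's, 'q, 't) rs_map \<Rightarrow> 'q set \<Rightarrow> 'p set" where
  "preim X f V = {x \<in> topspace (top_of X). pt f x \<in> V}"

definition unit_near :: "('p, 's, 'k) ringed_space \<Rightarrow> 'p set \<Rightarrow> 's \<Rightarrow> 'p \<Rightarrow> bool" where
  "unit_near X U s x \<longleftrightarrow>
     (\<exists>W. openin (top_of X) W \<and> x \<in> W \<and> W \<subseteq> U \<and> restr X U W s \<in> Units (sections X W))"

text \<open>
  The last conjunct is locality of the induced maps on stalks: \<open>unit_near\<close> says that the germ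
  of \<open>s\<close> at \<open>x\<close> is a unit of the stalk.
\<close>

definition is_morphism ::
  "('p, 's, 'k) ringed_space \<Rightarrow> ('q, 't, 'k) ringed_space \<Rightarrow> ('p, 's, 'q, 't) rs_map \<Rightarrow> bool" where
  "is_morphism X Y f \<longleftrightarrow>
     continuous_map (top_of X) (top_of Y) (pt f) \<and>
     (\<forall>V. openin (top_of Y) V \<longrightarrow>
        comap f V \<in> ring_hom (sections Y V) (sections X (preim X f V))) \<and>
     (\<forall>V W. openin (top_of Y) V \<longrightarrow> openin (top_of Y) W \<longrightarrow> W \<subseteq> V \<longrightarrow>
        (\<forall>s \<in> carrier (sections Y V).
           comap f W (restr Y V W s) = restr X (preim X f V) (preim X f W) (comap f V s))) \<and>
     (\<forall>c. comap f (topspace (top_of Y)) (scalar Y c) = scalar X c) \<and>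
     (\<forall>V. openin (top_of Y) V \<longrightarrow>
        (\<forall>s \<in> carrier (sections Y V). \<forall>x \<in> preim X f V.
           unit_near X (preim X f V) (comap f V s) x \<longrightarrow> unit_near Y V s (pt f x)))"

definition id_map :: "('p, 's, 'p, 's) rs_map" where
  "id_map = \<lparr>pt = (\<lambda>x. x), comap = (\<lambda>V s. s)\<rparr>"

text \<open>Composite of \<open>f\<close> from \<open>X\<close> to \<open>Y\<close> followed by \<open>g\<close> from \<open>Y\<close>; the first argument is \<open>Y\<close>.\<close>

definition comp_map ::
  "('q, 't, 'k) ringed_space \<Rightarrow> ('q, 't, 'r, 'u) rs_map \<Rightarrow> ('p, 's, 'q, 't) rs_map
     \<Rightarrow> ('p, 's, 'r, 'u) rs_map" where
  "comp_map Y g f = \<lparr>pt = pt g \<circ> pt f, comap = (\<lambda>W. comap f (preim Y g W) \<circ> comap g W)\<rparr>"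

text \<open>Equality as morphisms, i.e. disregarding values outside the meaningful domains.\<close>

definition same_map ::
  "('p, 's, 'k) ringed_space \<Rightarrow> ('q, 't, 'k) ringed_space
     \<Rightarrow> ('p, 's, 'q, 't) rs_map \<Rightarrow> ('p, 's, 'q, 't) rs_map \<Rightarrow> bool" where
  "same_map X Y f g \<longleftrightarrow>
     (\<forall>x \<in> topspace (top_of X). pt f x = pt g x) \<and>
     (\<forall>V. openin (top_of Y) V \<longrightarrow>
        (\<forall>s \<in> carrier (sections Y V). comap f V s = comap g V s))"

definition is_isomorphism ::
  "('p, 's, 'k) ringed_space \<Rightarrow> ('q, 't, 'k) ringed_space \<Rightarrow> ('p, 's, 'q, 't) rs_map \<Rightarrow> bool" where
  "is_isomorphism X Y f \<longleftrightarrow> is_morphism X Y f \<and>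
     (\<exists>g. is_morphism Y X g \<and>
        same_map X X (comp_map Y g f) id_map \<and> same_map Y Y (comp_map X f g) id_map)"

abbreviation is_automorphism ::
  "('p, 's, 'k) ringed_space \<Rightarrow> ('p, 's, 'p, 's) rs_map \<Rightarrow> bool" where
  "is_automorphism X f \<equiv> is_isomorphism X X f"

text \<open>
  A closed subscheme of \<open>X\<close> is a closed immersion \<open>i\<close> from \<open>Z\<close> to \<open>X\<close>, given as the pair
  \<open>(Z, i)\<close>, where two closed immersions are the same closed subscheme when they differ by an
  isomorphism of their sources over \<open>X\<close>. The image of \<open>(Z, i)\<close> under an automorphism \<open>f\<close> of \<open>X\<close>
  is \<open>f \<circ> i\<close>.
\<close>

definition same_closed_subscheme ::
  "('q, 't, 'k) ringed_space
     \<Rightarrow> ('p, 's, 'k) ringed_space \<times> ('p, 's, 'q, 't) rs_map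
     \<Rightarrow> ('r, 'u, 'k) ringed_space \<times> ('r, 'u, 'q, 't) rs_map \<Rightarrow> bool" where
  "same_closed_subscheme X = (\<lambda>(Y, i) (Z, j).
     \<exists>h. is_isomorphism Y Z h \<and> same_map Y X (comp_map Z j h) i)"

definition image_subscheme ::
  "('q, 't, 'k) ringed_space \<Rightarrow> ('q, 't, 'q, 't) rs_map
     \<Rightarrow> ('p, 's, 'k) ringed_space \<times> ('p, 's, 'q, 't) rs_map
     \<Rightarrow> ('p, 's, 'k) ringed_space \<times> ('p, 's, 'q, 't) rs_map" where
  "image_subscheme X f = (\<lambda>(Z, i). (Z, comp_map X f i))"


section \<open>Proj of a graded algebra\<close>

record ('a, 'k) graded_algebra = "'a ring" +
  gpart :: "nat \<Rightarrow> 'a set"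
  const :: "'k \<Rightarrow> 'a"

definition homogeneous :: "('a, 'k) graded_algebra \<Rightarrow> 'a set" where
  "homogeneous R = (\<Union>n. gpart R n)"

definition irrelevant_ideal :: "('a, 'k) graded_algebra \<Rightarrow> 'a set" where
  "irrelevant_ideal R = Idl\<^bsub>R\<^esub> (\<Union>n\<in>{0<..}. gpart R n)"

definition homogeneous_ideal :: "('a, 'k) graded_algebra \<Rightarrow> 'a set \<Rightarrow> bool" where
  "homogeneous_ideal R I \<longleftrightarrow> ideal I R \<and> Idl\<^bsub>R\<^esub> (I \<inter> homogeneous R) = I"

definition proj_points :: "('a, 'k) graded_algebra \<Rightarrow> 'a set set" where
  "proj_points R =
     {p. primeideal p R \<and> homogeneous_ideal R p \<and> \<not> irrelevant_ideal R \<subseteq> p}"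

definition vanishing :: "('a, 'k) graded_algebra \<Rightarrow> 'a set \<Rightarrow> 'a set set" where
  "vanishing R I = {p \<in> proj_points R. I \<subseteq> p}"

text \<open>
  The complements of the sets \<open>V(I)\<close> already form a topology; generating only avoids having
  to prove this at the point of definition.
\<close>

definition zariski :: "('a, 'k) graded_algebra \<Rightarrow> 'a set topology" where
  "zariski R = topology_generated_by {proj_points R - vanishing R I | I. homogeneous_ideal R I}"

text \<open>
  The homogeneous localization at \<open>p\<close>, i.e. the degree \<open>0\<close> part of the localization at the
  homogeneous elements outside \<open>p\<close>. Fractions are equivalence classes of pairs.
\<close>

definition hpairs :: "('a, 'k) graded_algebra \<Rightarrow> 'a set \<Rightarrow> ('a \<times> 'a) set" where
  "hpairs R p = {(a, b). (\<exists>n. a \<in> gpart R n \<and> b \<in> gpart R n) \<and> b \<notin> p}"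

definition hrel :: "('a, 'k) graded_algebra \<Rightarrow> 'a set \<Rightarrow> (('a \<times> 'a) \<times> ('a \<times> 'a)) set" where
  "hrel R p = {((a, b), (c, d)). (a, b) \<in> hpairs R p \<and> (c, d) \<in> hpairs R p \<and>
     (\<exists>t \<in> homogeneous R - p. t \<otimes>\<^bsub>R\<^esub> (a \<otimes>\<^bsub>R\<^esub> d) = t \<otimes>\<^bsub>R\<^esub> (c \<otimes>\<^bsub>R\<^esub> b))}"

definition hfrac :: "('a, 'k) graded_algebra \<Rightarrow> 'a set \<Rightarrow> 'a \<Rightarrow> 'a \<Rightarrow> ('a \<times> 'a) set" where
  "hfrac R p a b = hrel R p `` {(a, b)}"

definition hloc :: "('a, 'k) graded_algebra \<Rightarrow> 'a set \<Rightarrow> ('a \<times> 'a) set ring" where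
  "hloc R p =
     \<lparr>carrier = hpairs R p // hrel R p,
      mult = (\<lambda>x y. \<Union>(a, b)\<in>x. \<Union>(c, d)\<in>y. hfrac R p (a \<otimes>\<^bsub>R\<^esub> c) (b \<otimes>\<^bsub>R\<^esub> d)),
      one = hfrac R p \<one>\<^bsub>R\<^esub> \<one>\<^bsub>R\<^esub>,
      zero = hfrac R p \<zero>\<^bsub>R\<^esub> \<one>\<^bsub>R\<^esub>,
      add = (\<lambda>x y. \<Union>(a, b)\<in>x. \<Union>(c, d)\<in>y.
               hfrac R p (a \<otimes>\<^bsub>R\<^esub> d \<oplus>\<^bsub>R\<^esub> c \<otimes>\<^bsub>R\<^esub> b) (b \<otimes>\<^bsub>R\<^esub> d))\<rparr>"

type_synonym 'a proj_section = "'a set \<Rightarrow> ('a \<times> 'a) set"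

definition locally_fraction ::
  "('a, 'k) graded_algebra \<Rightarrow> 'a set set \<Rightarrow> 'a proj_section \<Rightarrow> bool" where
  "locally_fraction R U s \<longleftrightarrow>
     (\<forall>p \<in> U. \<exists>V. openin (zariski R) V \<and> p \<in> V \<and> V \<subseteq> U \<and>
        (\<exists>n. \<exists>a \<in> gpart R n. \<exists>b \<in> gpart R n. \<forall>q \<in> V. b \<notin> q \<and> s q = hfrac R q a b))"

definition proj_sections ::
  "('a, 'k) graded_algebra \<Rightarrow> 'a set set \<Rightarrow> 'a proj_section ring" where
  "proj_sections R U =
     \<lparr>carrier = {s \<in> (\<Pi>\<^sub>E p\<in>U. carrier (hloc R p)). locally_fraction R U s},
      mult = (\<lambda>s t. \<lambda>p\<in>U. s p \<otimes>\<^bsub>hloc R p\<^esub> t p),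
      one = (\<lambda>p\<in>U. \<one>\<^bsub>hloc R p\<^esub>),
      zero = (\<lambda>p\<in>U. \<zero>\<^bsub>hloc R p\<^esub>),
      add = (\<lambda>s t. \<lambda>p\<in>U. s p \<oplus>\<^bsub>hloc R p\<^esub> t p)\<rparr>"

definition Proj :: "('a, 'k) graded_algebra \<Rightarrow> ('a set, 'a proj_section, 'k) ringed_space" where
  "Proj R =
     \<lparr>top_of = zariski R,
      sections = proj_sections R,
      restr = (\<lambda>U V s. restrict s V),
      scalar = (\<lambda>c. \<lambda>p\<in>proj_points R. hfrac R p (const R c) \<one>\<^bsub>R\<^esub>)\<rparr>"

text \<open>
  The closed subscheme of \<open>Proj R\<close> defined by a homogeneous ideal \<open>I\<close> is \<open>Proj (R / I)\<close> with
  the morphism induced by the quotient map: a prime goes to its preimage, and a fraction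
  \<open>a / b\<close> to the fraction of the residue classes. The union below is over the representatives
  of a fraction, all of which give the same class.
\<close>

definition graded_quotient ::
  "('a, 'k) graded_algebra \<Rightarrow> 'a set \<Rightarrow> ('a set, 'k) graded_algebra" where
  "graded_quotient R I =
     ring.extend (R Quot I)
       (graded_algebra.fields (\<lambda>n. (\<lambda>a. I +>\<^bsub>R\<^esub> a) ` gpart R n) (\<lambda>c. I +>\<^bsub>R\<^esub> const R c))"

definition quotient_immersion ::
  "('a, 'k) graded_algebra \<Rightarrow> 'a set
     \<Rightarrow> ('a set set, 'a set proj_section, 'a set, 'a proj_section) rs_map" where
  "quotient_immersion R I =
     (let pull = (\<lambda>q. {a \<in> carrier R. I +>\<^bsub>R\<^esub> a \<in> q}) in
      \<lparr>pt = pull,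
       comap = (\<lambda>U s. \<lambda>q\<in>{q \<in> proj_points (graded_quotient R I). pull q \<in> U}.
         \<Union>(a, b)\<in>s (pull q). hfrac (graded_quotient R I) q (I +>\<^bsub>R\<^esub> a) (I +>\<^bsub>R\<^esub> b))\<rparr>)"

definition closed_subscheme_of_ideal ::
  "('a, 'k) graded_algebra \<Rightarrow> 'a set
     \<Rightarrow> ('a set set, 'a set proj_section, 'k) ringed_space
        \<times> ('a set set, 'a set proj_section, 'a set, 'a proj_section) rs_map" where
  "closed_subscheme_of_ideal R I = (Proj (graded_quotient R I), quotient_immersion R I)"


section \<open>Projective space and eigenschemes\<close>

text \<open>
  Polynomials over \<open>'k\<close> in variables indexed by the finite type \<open>'n\<close>, whose cardinality is
  the dimension \<open>r\<close> of the matrices.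
\<close>

type_synonym ('n, 'k) mpoly = "('n \<Rightarrow>\<^sub>0 nat) \<Rightarrow>\<^sub>0 'k"

definition Var :: "'n \<Rightarrow> ('n, 'k::field) mpoly" where
  "Var i = Poly_Mapping.single (Poly_Mapping.single i 1) 1"

definition Const :: "'k \<Rightarrow> ('n, 'k::field) mpoly" where
  "Const c = Poly_Mapping.single 0 c"

definition forms :: "nat \<Rightarrow> ('n::finite, 'k::field) mpoly set" where
  "forms d = {f. \<forall>m \<in> Poly_Mapping.keys f. (\<Sum>i\<in>UNIV. Poly_Mapping.lookup m i) = d}"

definition poly_algebra :: "(('n::finite, 'k::field) mpoly, 'k) graded_algebra" where
  "poly_algebra =
     \<lparr>carrier = UNIV, mult = (*), one = 1, zero = 0, add = (+), gpart = forms, const = Const\<rparr>"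

definition projective_space ::
  "(('n::finite, 'k::field) mpoly set, ('n, 'k) mpoly proj_section, 'k) ringed_space" where
  "projective_space = Proj poly_algebra"

definition var_vector :: "('n::finite, 'k::field) mpoly ^ 'n" where
  "var_vector = (\<chi> i. Var i)"

definition const_matrix :: "'k::field ^ 'n ^ 'n \<Rightarrow> ('n::finite, 'k) mpoly ^ 'n ^ 'n" where
  "const_matrix A = (\<chi> i j. Const (A $ i $ j))"

definition eigen_matrix :: "'k::field ^ 'n ^ 'n \<Rightarrow> ('n::finite, 'k) mpoly ^ 2 ^ 'n" where
  "eigen_matrix A =
     (\<chi> i k. if k = 1 then (const_matrix A *v var_vector) $ i else var_vector $ i)"

text \<open>
  A \<open>2 \<times> 2\<close> minor of a two-column matrix is given by an injective choice of rows. As \<open>'n\<close> is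
  not ordered, each pair of rows is taken in both orders, so each minor occurs with both signs.
\<close>

definition minors2 :: "'a::comm_ring_1 ^ 2 ^ 'n \<Rightarrow> 'a set" where
  "minors2 M = {det (\<chi> k l. M $ f k $ l) | f :: 2 \<Rightarrow> 'n. inj f}"

definition eigen_ideal :: "'k::field ^ 'n ^ 'n \<Rightarrow> ('n::finite, 'k) mpoly set" where
  "eigen_ideal A = Idl\<^bsub>poly_algebra\<^esub> (minors2 (eigen_matrix A))"

definition eigenscheme ::
  "'k::field ^ 'n ^ 'n \<Rightarrow>
     (('n::finite, 'k) mpoly set set, ('n, 'k) mpoly set proj_section, 'k) ringed_space
     \<times> (('n, 'k) mpoly set set, ('n, 'k) mpoly set proj_section,
         ('n, 'k) mpoly set, ('n, 'k) mpoly proj_section) rs_map" where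
  "eigenscheme A = closed_subscheme_of_ideal poly_algebra (eigen_ideal A)"

definition similar_matrices :: "'k::field ^ 'n ^ 'n \<Rightarrow> 'k ^ 'n ^ 'n::finite \<Rightarrow> bool" where
  "similar_matrices A B \<longleftrightarrow> (\<exists>P. invertible P \<and> B = matrix_inv P ** A ** P)"

end

theory Submission
  imports Defs
begin

text \<open>
  If \<open>B = P\<^sup>-\<^sup>1 A P\<close>, then the substitution \<open>x \<mapsto> P x\<close> turns the matrix \<open>(A x | x)\<close> into
  \<open>(A P x | P x) = P (B x | x)\<close>. Left multiplication by an invertible matrix does not change the
  ideal of \<open>2 \<times> 2\<close> minors, so this graded automorphism of the polynomial ring carries \<open>I\<^sub>A\<close> to
  \<open>I\<^sub>B\<close>. Since \<open>Proj\<close> is functorial for graded isomorphisms, it yields an automorphism of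
  projective space and a compatible isomorphism of the two quotient schemes.
\<close>

section \<open>Isomorphisms of Proj induced by graded isomorphisms\<close>

text \<open>Primes, fractions and cosets are all encoded as sets, so a bijective homomorphism
  \<open>\<sigma>\<close> acts on each of them by set image. This is why only isomorphisms are
  treated, with the inverse \<open>\<tau>\<close> as a parameter: a fact about
  \<open>\<sigma>\<close> has a mirror image for \<open>\<tau>\<close>, and half of each two-sided
  claim comes from \<open>swap\<close>. The same locale is used twice, for the substitution on
  polynomials and for its set image on cosets; the second use yields the isomorphism between the two
  eigenschemes. The price is care about domains: \<open>\<sigma>\<close> and \<open>\<tau>\<close>
  cancel only on carriers, and comaps take the value \<open>undefined\<close> away from the preimage
  of the open set. As to direction, Proj is contravariant: the map of points is induced by the
  inverse substitution, so it sends Z_B to Z_A, as the theorem asks.\<close>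

lemma ring_hom_Units:
  assumes f: "f \<in> ring_hom A B" and x: "x \<in> Units A"
  shows "f x \<in> Units B"
proof -
  from x obtain y where "x \<in> carrier A" "y \<in> carrier A" "x \<otimes>\<^bsub>A\<^esub> y = \<one>\<^bsub>A\<^esub>" "y \<otimes>\<^bsub>A\<^esub> x = \<one>\<^bsub>A\<^esub>"
    unfolding Units_def by blast
  then have "f x \<in> carrier B" "f y \<in> carrier B" "f x \<otimes>\<^bsub>B\<^esub> f y = \<one>\<^bsub>B\<^esub>" "f y \<otimes>\<^bsub>B\<^esub> f x = \<one>\<^bsub>B\<^esub>"
    by (simp_all add: ring_hom_closed[OF f] ring_hom_one[OF f] flip: ring_hom_mult[OF f])
  then show ?thesis unfolding Units_def by blast
qed

text \<open>These axioms pass to the quotient by an arbitrary ideal, so the same theory serves the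
  polynomial ring and its coset rings.\<close>

locale graded_cring = cring R for R :: "('a, 'k) graded_algebra" (structure) +
  assumes gpart_carrier: "gpart R n \<subseteq> carrier R"
    and one_gpart: "\<one> \<in> gpart R 0"
    and const_carrier: "const R c \<in> carrier R"
begin

lemma homogeneous_carrier: "homogeneous R \<subseteq> carrier R"
  using gpart_carrier by (auto simp: homogeneous_def)

lemma proj_point_subset: "p \<in> proj_points R \<Longrightarrow> p \<subseteq> carrier R"
  unfolding proj_points_def
  by (auto dest!: primeideal.axioms(1) dest: additive_subgroup.a_subset ideal.axioms(1))

text \<open>The unit ideal is homogeneous, since 1 has degree 0, and no prime contains it. Hence the
  whole set of points is itself one of the generating open sets.\<close>

lemma topspace_zariski: "topspace (zariski R) = proj_points R"
proof -
  have "one R \<in> Idl (carrier R \<inter> homogeneous R)"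
    using genideal_self[of "carrier R \<inter> homogeneous R"] one_gpart
    by (auto simp: homogeneous_def)
  then have "homogeneous_ideal R (carrier R)"
    unfolding homogeneous_ideal_def
    using ideal.one_imp_carrier[OF genideal_ideal[of "carrier R \<inter> homogeneous R"]] oneideal
    by blast
  moreover have "vanishing R (carrier R) = {}"
  proof -
    have False if "p \<in> proj_points R" "carrier R \<subseteq> p" for p
      using that proj_point_subset[of p] primeideal.I_notcarr[of p R]
      by (auto simp: proj_points_def)
    then show ?thesis by (auto simp: vanishing_def)
  qed
  ultimately show ?thesis
    unfolding zariski_def topology_generated_by_topspace by blast
qed

lemma openin_zariski_subset: "openin (zariski R) U \<Longrightarrow> U \<subseteq> proj_points R"
  using openin_subset[of "zariski R" U] by (simp add: topspace_zariski)

lemma hpairs_subset: "hpairs R p \<subseteq> carrier R \<times> carrier R"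
  using gpart_carrier by (auto simp: hpairs_def)

lemma hfrac_subset: "hfrac R p a b \<subseteq> carrier R \<times> carrier R"
  using hpairs_subset[of p] by (auto simp: hfrac_def hrel_def)

text \<open>Needed whenever \<open>\<tau>\<close> is cancelled against \<open>\<sigma>\<close> on a
  fraction, since the representatives must lie in the carrier.\<close>

lemma hloc_subset: "X \<in> carrier (hloc R p) \<Longrightarrow> X \<subseteq> carrier R \<times> carrier R"
proof -
  assume "X \<in> carrier (hloc R p)"
  then obtain a b where "X = hfrac R p a b"
    by (auto simp: hloc_def quotient_def simp flip: hfrac_def)
  then show ?thesis by (simp add: hfrac_subset)
qed

end

text \<open>
  The points of \<open>Proj S\<close> are pulled back along \<open>\<sigma>\<close> from \<open>R\<close> to \<open>S\<close>. For bijective \<open>\<sigma>\<close> this is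
  the image under its inverse \<open>\<tau>\<close>, and a fraction, being a set of pairs, is mapped as a set.
\<close>

definition proj_map ::
  "('b, 'k) graded_algebra \<Rightarrow> ('a \<Rightarrow> 'b) \<Rightarrow> ('b \<Rightarrow> 'a)
     \<Rightarrow> ('b set, 'b proj_section, 'a set, 'a proj_section) rs_map" where
  "proj_map S \<sigma> \<tau> =
     \<lparr>pt = (\<lambda>q. \<tau> ` q),
      comap = (\<lambda>V s. \<lambda>q\<in>{q \<in> proj_points S. \<tau> ` q \<in> V}. map_prod \<sigma> \<sigma> ` s (\<tau> ` q))\<rparr>"

locale graded_iso = R: graded_cring R + S: graded_cring S
  for R :: "('a, 'k) graded_algebra" (structure)
    and S :: "('b, 'k) graded_algebra" (structure)
    and \<sigma> :: "'a \<Rightarrow> 'b" and \<tau> :: "'b \<Rightarrow> 'a" +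
  assumes hom: "\<sigma> \<in> ring_hom R S"
    and inv_hom: "\<tau> \<in> ring_hom S R"
    and left_inv: "a \<in> carrier R \<Longrightarrow> \<tau> (\<sigma> a) = a"
    and right_inv: "b \<in> carrier S \<Longrightarrow> \<sigma> (\<tau> b) = b"
    and gpart_hom: "a \<in> gpart R n \<Longrightarrow> \<sigma> a \<in> gpart S n"
    and gpart_inv: "b \<in> gpart S n \<Longrightarrow> \<tau> b \<in> gpart R n"
    and const_hom: "\<sigma> (const R c) = const S c"
begin

text \<open>Interpreted as \<open>sw\<close> in later proofs, this supplies every fact of the locale
  for \<open>\<tau>\<close> as well.\<close>

lemma swap: "graded_iso S R \<tau> \<sigma>"
proof unfold_locales
  show "\<tau> (const S c) = const R c" for c
    using left_inv[OF R.const_carrier, of c] by (simp add: const_hom)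
qed (use hom inv_hom left_inv right_inv gpart_hom gpart_inv in auto)

lemma closed: "a \<in> carrier R \<Longrightarrow> \<sigma> a \<in> carrier S"
  using hom by (rule ring_hom_closed)

lemma inj_on_carrier: "inj_on \<sigma> (carrier R)"
  by (metis inj_onI left_inv)

lemma image_inv_image: "X \<subseteq> carrier R \<Longrightarrow> \<tau> ` \<sigma> ` X = X"
  unfolding image_image by (subst image_cong[OF refl, of _ _ id]) (auto simp: left_inv)

lemma map_prod_inv: "X \<subseteq> carrier R \<times> carrier R \<Longrightarrow> map_prod \<tau> \<tau> ` map_prod \<sigma> \<sigma> ` X = X"
  unfolding image_image by (subst image_cong[OF refl, of _ _ id]) (auto simp: left_inv)

lemma image_subset_carrier: "X \<subseteq> carrier R \<Longrightarrow> \<sigma> ` X \<subseteq> carrier S"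
  using closed by auto

lemma mem_image_iff: "X \<subseteq> carrier R \<Longrightarrow> a \<in> carrier R \<Longrightarrow> \<sigma> a \<in> \<sigma> ` X \<longleftrightarrow> a \<in> X"
  using inj_on_carrier by (meson inj_on_image_mem_iff)

section \<open>Transport of ideals, gradings and homogeneous primes\<close>

lemma ring_hom_ring_inv: "ring_hom_ring S R \<tau>"
  using inv_hom by (intro ring_hom_ringI2 R.ring_axioms S.ring_axioms)

text \<open>Images under \<open>\<sigma>\<close> are preimages under \<open>\<tau>\<close>, and
  preimages of ideals and of primes under a homomorphism are again such.\<close>

lemma image_eq_vimage: "X \<subseteq> carrier R \<Longrightarrow> \<sigma> ` X = {b \<in> carrier S. \<tau> b \<in> X}"
  by (auto simp: closed left_inv right_inv subset_iff intro: rev_image_eqI[of "\<tau> _"])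

lemma ideal_image: "ideal I R \<Longrightarrow> ideal (\<sigma> ` I) S"

  using ring_hom_ring.ideal_vimage[OF ring_hom_ring_inv, of I]
  by (simp add: image_eq_vimage additive_subgroup.a_subset[OF ideal.axioms(1)])

lemma primeideal_image: "primeideal I R \<Longrightarrow> primeideal (\<sigma> ` I) S"

  using ring_hom_ring.primeideal_vimage[OF ring_hom_ring_inv S.is_cring, of I]
  by (simp add: image_eq_vimage additive_subgroup.a_subset[OF ideal.axioms(1)] primeideal.axioms(1))

lemma Idl_image_le:
  assumes "X \<subseteq> carrier R" shows "Idl\<^bsub>S\<^esub> (\<sigma> ` X) \<subseteq> \<sigma> ` (Idl\<^bsub>R\<^esub> X)"
  using assms by (intro S.genideal_minimal ideal_image R.genideal_ideal image_mono R.genideal_self)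

text \<open>The inclusion still missing is \<open>Idl_image_le\<close> for \<open>\<tau>\<close> and
  the transported generators, pushed forward by \<open>\<sigma>\<close>.\<close>

lemma Idl_image:
  assumes "X \<subseteq> carrier R" shows "\<sigma> ` (Idl\<^bsub>R\<^esub> X) = Idl\<^bsub>S\<^esub> (\<sigma> ` X)"
proof -
  interpret sw: graded_iso S R \<tau> \<sigma> by (rule swap)
  have sub: "\<sigma> ` X \<subseteq> carrier S" using assms by (rule image_subset_carrier)
  have "Idl\<^bsub>R\<^esub> X \<subseteq> \<tau> ` (Idl\<^bsub>S\<^esub> (\<sigma> ` X))"
    using sw.Idl_image_le[OF sub] assms by (simp add: image_inv_image)
  then have "\<sigma> ` (Idl\<^bsub>R\<^esub> X) \<subseteq> \<sigma> ` \<tau> ` (Idl\<^bsub>S\<^esub> (\<sigma> ` X))" by (rule image_mono)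
  also have "\<dots> = Idl\<^bsub>S\<^esub> (\<sigma> ` X)"
    using additive_subgroup.a_subset[OF ideal.axioms(1)[OF S.genideal_ideal[OF sub]]]
    by (rule sw.image_inv_image)
  finally show ?thesis using Idl_image_le[OF assms] by blast
qed

lemma gpart_image: "\<sigma> ` gpart R n = gpart S n"
proof
  show "gpart S n \<subseteq> \<sigma> ` gpart R n"
  proof
    fix b assume b: "b \<in> gpart S n"
    then have "b = \<sigma> (\<tau> b)" using S.gpart_carrier right_inv by (metis subsetD)
    with gpart_inv[OF b] show "b \<in> \<sigma> ` gpart R n" by (rule rev_image_eqI)
  qed
qed (use gpart_hom in auto)

lemma homogeneous_image: "\<sigma> ` homogeneous R = homogeneous S"
  by (simp add: homogeneous_def image_UN gpart_image)

lemma homogeneous_ideal_image: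
  assumes "homogeneous_ideal R I" shows "homogeneous_ideal S (\<sigma> ` I)"
proof -
  have I: "ideal I R" "Idl\<^bsub>R\<^esub> (I \<inter> homogeneous R) = I"
    using assms by (auto simp: homogeneous_ideal_def)
  then have sub: "I \<subseteq> carrier R"
    by (metis additive_subgroup.a_subset ideal.axioms(1))
  \<comment> \<open>Injectivity on the carrier makes the image commute with the
    intersection.\<close>
  have "\<sigma> ` I \<inter> homogeneous S = \<sigma> ` (I \<inter> homogeneous R)"
    using inj_on_image_Int[OF inj_on_carrier sub R.homogeneous_carrier]
    by (simp add: homogeneous_image)
  then have "Idl\<^bsub>S\<^esub> (\<sigma> ` I \<inter> homogeneous S) = \<sigma> ` I"
    using Idl_image[of "I \<inter> homogeneous R"] sub I(2) by (metis le_infI1)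
  with I(1) ideal_image show ?thesis by (simp add: homogeneous_ideal_def)
qed

lemma irrelevant_image: "\<sigma> ` irrelevant_ideal R = irrelevant_ideal S"
proof -
  have "(\<Union>n\<in>{0<..}. gpart R n) \<subseteq> carrier R" using R.gpart_carrier by auto
  from Idl_image[OF this] show ?thesis
    by (simp add: irrelevant_ideal_def image_UN gpart_image)
qed

lemma proj_point_image:
  assumes "p \<in> proj_points R" shows "\<sigma> ` p \<in> proj_points S"
proof -
  have "irrelevant_ideal R \<subseteq> p" if "irrelevant_ideal S \<subseteq> \<sigma> ` p"
  proof -
    have "(\<Union>n\<in>{0<..}. gpart R n) \<subseteq> carrier R"
      using R.gpart_carrier by auto
    then have "irrelevant_ideal R \<subseteq> carrier R"
      unfolding irrelevant_ideal_def
      by (rule additive_subgroup.a_subset[OF ideal.axioms(1)[OF R.genideal_ideal]])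
    moreover have "\<tau> ` \<sigma> ` irrelevant_ideal R \<subseteq> \<tau> ` \<sigma> ` p"
      using that irrelevant_image by (metis image_mono)
    ultimately show ?thesis
      using R.proj_point_subset[OF assms] by (simp add: image_inv_image)
  qed
  with assms show ?thesis
    by (auto simp: proj_points_def primeideal_image homogeneous_ideal_image)
qed

section \<open>Transport of homogeneous localizations\<close>

lemma hpairs_image:
  assumes "p \<in> proj_points R" and "(a, b) \<in> hpairs R p"
  shows "(\<sigma> a, \<sigma> b) \<in> hpairs S (\<sigma> ` p)"
proof -
  have "b \<in> carrier R" using assms(2) R.hpairs_subset by blast
  then show ?thesis using assms gpart_hom mem_image_iff[OF R.proj_point_subset, of p b]
    by (auto simp: hpairs_def)
qed

lemma hrel_image:
  assumes p: "p \<in> proj_points R" and r: "((a, b), (c, d)) \<in> hrel R p"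
  shows "((\<sigma> a, \<sigma> b), (\<sigma> c, \<sigma> d)) \<in> hrel S (\<sigma> ` p)"
proof -
  from r obtain t where hp: "(a, b) \<in> hpairs R p" "(c, d) \<in> hpairs R p"
    and t: "t \<in> homogeneous R" "t \<notin> p" and
      eq: "t \<otimes>\<^bsub>R\<^esub> (a \<otimes>\<^bsub>R\<^esub> d) = t \<otimes>\<^bsub>R\<^esub> (c \<otimes>\<^bsub>R\<^esub> b)"
    by (auto simp: hrel_def)
  then have c: "a \<in> carrier R" "b \<in> carrier R" "c \<in> carrier R" "d \<in> carrier R" "t \<in> carrier R"
    using R.hpairs_subset R.homogeneous_carrier by blast+
  have "\<sigma> t \<in> homogeneous S - \<sigma> ` p"
    using t c homogeneous_image mem_image_iff[OF R.proj_point_subset[OF p]] by auto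
  moreover have "\<sigma> t \<otimes>\<^bsub>S\<^esub> (\<sigma> a \<otimes>\<^bsub>S\<^esub> \<sigma> d) = \<sigma> t \<otimes>\<^bsub>S\<^esub> (\<sigma> c \<otimes>\<^bsub>S\<^esub> \<sigma> b)"
    using arg_cong[OF eq, of \<sigma>] c by (simp add: ring_hom_mult[OF hom])
  ultimately show ?thesis
    using hp hpairs_image[OF p] by (auto simp: hrel_def)
qed

text \<open>A class must be mapped onto a whole class, so \<open>hrel_image\<close> is used in both
  directions: for \<open>\<sigma>\<close> at \<open>p\<close>, and for \<open>\<tau>\<close> at the
  image of \<open>p\<close>.\<close>

lemma hfrac_image:
  assumes p: "p \<in> proj_points R" and c: "a \<in> carrier R" "b \<in> carrier R"
  shows "map_prod \<sigma> \<sigma> ` hfrac R p a b = hfrac S (\<sigma> ` p) (\<sigma> a) (\<sigma> b)"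
proof
  interpret sw: graded_iso S R \<tau> \<sigma> by (rule swap)
  show "map_prod \<sigma> \<sigma> ` hfrac R p a b \<subseteq> hfrac S (\<sigma> ` p) (\<sigma> a) (\<sigma> b)"
    using hrel_image[OF p] by (auto simp: hfrac_def)
  have inv: "\<tau> ` \<sigma> ` p = p" using R.proj_point_subset[OF p] by (rule image_inv_image)
  show "hfrac S (\<sigma> ` p) (\<sigma> a) (\<sigma> b) \<subseteq> map_prod \<sigma> \<sigma> ` hfrac R p a b"
  proof clarify
    fix c' d' assume r: "(c', d') \<in> hfrac S (\<sigma> ` p) (\<sigma> a) (\<sigma> b)"
    then have "(\<tau> c', \<tau> d') \<in> hfrac R p a b"
      using sw.hrel_image[OF proj_point_image[OF p], of "\<sigma> a" "\<sigma> b" c' d'] c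
      by (simp add: hfrac_def inv left_inv)
    moreover have "(c', d') = map_prod \<sigma> \<sigma> (\<tau> c', \<tau> d')"
      using subsetD[OF S.hfrac_subset r] by (simp add: right_inv)
    ultimately show "(c', d') \<in> map_prod \<sigma> \<sigma> ` hfrac R p a b" by (metis image_eqI)
  qed
qed

lemma hloc_closed:
  assumes p: "p \<in> proj_points R" and X: "X \<in> carrier (hloc R p)"
  shows "map_prod \<sigma> \<sigma> ` X \<in> carrier (hloc S (\<sigma> ` p))"
proof -
  from X obtain a b where ab: "(a, b) \<in> hpairs R p" and X: "X = hfrac R p a b"
    by (auto simp: hloc_def quotient_def hfrac_def)
  then have "a \<in> carrier R" "b \<in> carrier R" using R.hpairs_subset by blast+
  then show ?thesis
    using quotientI[OF hpairs_image[OF p ab], of "hrel S (\<sigma> ` p)"]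
    by (simp add: X hfrac_image[OF p]) (simp add: hloc_def hfrac_def)
qed

lemma hloc_hom:
  assumes p: "p \<in> proj_points R"
  shows "(`) (map_prod \<sigma> \<sigma>) \<in> ring_hom (hloc R p) (hloc S (\<sigma> ` p))"
proof (rule ring_hom_memI)
  fix X Y assume "X \<in> carrier (hloc R p)" "Y \<in> carrier (hloc R p)"
  then have sub: "X \<subseteq> carrier R \<times> carrier R" "Y \<subseteq> carrier R \<times> carrier R"
    by (auto dest: R.hloc_subset)
  \<comment> \<open>Sum and product of fractions are unions over representatives with the same
    denominator and differ only in the numerator \<open>f\<close>. Images commute with such unions,
    so one computation, representative by representative, covers both operations.\<close>
  have *: "map_prod \<sigma> \<sigma> ` (\<Union>(a, b)\<in>X. \<Union>(c, d)\<in>Y. hfrac R p (f a b c d) (b \<otimes>\<^bsub>R\<^esub> d))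
        = (\<Union>(a, b)\<in>map_prod \<sigma> \<sigma> ` X. \<Union>(c, d)\<in>map_prod \<sigma> \<sigma> ` Y.
             hfrac S (\<sigma> ` p) (g a b c d) (b \<otimes>\<^bsub>S\<^esub> d))"
    if fg: "\<And>a b c d. a \<in> carrier R \<Longrightarrow> b \<in> carrier R \<Longrightarrow> c \<in> carrier R \<Longrightarrow> d \<in> carrier R \<Longrightarrow>
           f a b c d \<in> carrier R \<and> \<sigma> (f a b c d) = g (\<sigma> a) (\<sigma> b) (\<sigma> c) (\<sigma> d)" for f g
  proof -
    have "map_prod \<sigma> \<sigma> ` hfrac R p (f (fst x) (snd x) (fst y) (snd y)) (snd x \<otimes>\<^bsub>R\<^esub> snd y)
        = hfrac S (\<sigma> ` p) (g (\<sigma> (fst x)) (\<sigma> (snd x)) (\<sigma> (fst y)) (\<sigma> (snd y)))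
            (\<sigma> (snd x) \<otimes>\<^bsub>S\<^esub> \<sigma> (snd y))"
      if "x \<in> X" "y \<in> Y" for x y
    proof -
      have "fst x \<in> carrier R" "snd x \<in> carrier R" "fst y \<in> carrier R" "snd y \<in> carrier R"
        using that sub by auto
      then show ?thesis by (simp add: hfrac_image[OF p] fg ring_hom_mult[OF hom])
    qed
    then show ?thesis
      by (simp add: image_UN split_beta)
  qed
  show "map_prod \<sigma> \<sigma> ` (X \<otimes>\<^bsub>hloc R p\<^esub> Y)
      = map_prod \<sigma> \<sigma> ` X \<otimes>\<^bsub>hloc S (\<sigma> ` p)\<^esub> map_prod \<sigma> \<sigma> ` Y"
    unfolding hloc_def monoid.simps by (rule *) (simp add: ring_hom_mult[OF hom])
  show "map_prod \<sigma> \<sigma> ` (X \<oplus>\<^bsub>hloc R p\<^esub> Y)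
      = map_prod \<sigma> \<sigma> ` X \<oplus>\<^bsub>hloc S (\<sigma> ` p)\<^esub> map_prod \<sigma> \<sigma> ` Y"
    unfolding hloc_def ring.simps
    by (rule *) (simp add: ring_hom_mult[OF hom] ring_hom_add[OF hom])
next
  show "map_prod \<sigma> \<sigma> ` \<one>\<^bsub>hloc R p\<^esub> = \<one>\<^bsub>hloc S (\<sigma> ` p)\<^esub>"
    by (simp add: hloc_def hfrac_image[OF p] ring_hom_one[OF hom])
qed (rule hloc_closed[OF p])

section \<open>Continuity of the map of points\<close>

lemma vimage_vanishing_compl:
  assumes I: "homogeneous_ideal R I"
  shows "{q \<in> proj_points S. \<tau> ` q \<in> proj_points R - vanishing R I}
       = proj_points S - vanishing S (\<sigma> ` I)"
proof -
  interpret sw: graded_iso S R \<tau> \<sigma> by (rule swap)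
  have sub: "I \<subseteq> carrier R" using I
    by (auto simp: homogeneous_ideal_def dest: additive_subgroup.a_subset ideal.axioms(1))
  \<comment> \<open>Apply \<open>\<sigma>\<close> to the left inclusion or \<open>\<tau>\<close> to
    the right one, and cancel.\<close>
  have "I \<subseteq> \<tau> ` q \<longleftrightarrow> \<sigma> ` I \<subseteq> q" if "q \<in> proj_points S" for q
    using image_inv_image[OF sub] sw.image_inv_image[OF S.proj_point_subset[OF that]]
    by (metis image_mono)
  then show ?thesis
    by (simp add: vanishing_def set_eq_iff sw.proj_point_image cong: conj_cong)
qed

lemma continuous_map_proj: "continuous_map (zariski S) (zariski R) ((`) \<tau>)"
proof -
  interpret sw: graded_iso S R \<tau> \<sigma> by (rule swap)
  show ?thesis
    unfolding zariski_def[of R] continuous_on_generated_topo_iff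
  proof (intro conjI allI impI)
    fix U assume "U \<in> {proj_points R - vanishing R I | I. homogeneous_ideal R I}"
    then obtain I where I: "homogeneous_ideal R I" and U: "U = proj_points R - vanishing R I"
      by blast
    have eq: "(`) \<tau> -` U \<inter> topspace (zariski S) = proj_points S - vanishing S (\<sigma> ` I)"
      unfolding vimage_vanishing_compl[OF I, symmetric] U S.topspace_zariski by blast
    show "openin (zariski S) ((`) \<tau> -` U \<inter> topspace (zariski S))"
      unfolding eq unfolding zariski_def
      using homogeneous_ideal_image[OF I] by (intro topology_generated_by_Basis) blast
  next
    \<comment> \<open>For a generated topology, continuity also asks that the image stay inside the
      union of the generators.\<close>
    have "\<Union> {proj_points R - vanishing R I | I. homogeneous_ideal R I} = proj_points R"
      using R.topspace_zariski unfolding zariski_def topology_generated_by_topspace .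
    then show "(`) \<tau> ` topspace (zariski S)
        \<subseteq> \<Union> {proj_points R - vanishing R I | I. homogeneous_ideal R I}"
      using sw.proj_point_image by (simp add: S.topspace_zariski image_subset_iff)
  qed
qed

lemma openin_vimage:
  "openin (zariski R) V \<Longrightarrow> openin (zariski S) {q \<in> proj_points S. \<tau> ` q \<in> V}"
  using openin_continuous_map_preimage[OF continuous_map_proj] by (simp add: S.topspace_zariski)

section \<open>Pulling back sections of the structure sheaf\<close>

lemma preim_proj_map: "preim (Proj S) (proj_map S \<sigma> \<tau>) V = {q \<in> proj_points S. \<tau> ` q \<in> V}"
  by (simp add: preim_def Proj_def proj_map_def S.topspace_zariski)

text \<open>A comap is evaluated at a point \<open>q\<close> of Proj S and reads its argument at the
  image of \<open>q\<close> under \<open>\<tau>\<close>. This lemma and the next two restate the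
  transport of fractions from that side.\<close>

lemma hloc_closed_point:
  assumes q: "q \<in> proj_points S" and X: "X \<in> carrier (hloc R (\<tau> ` q))"
  shows "map_prod \<sigma> \<sigma> ` X \<in> carrier (hloc S q)"
proof -
  interpret sw: graded_iso S R \<tau> \<sigma> by (rule swap)
  show ?thesis
    using hloc_closed[OF sw.proj_point_image[OF q] X]
    by (simp add: sw.image_inv_image[OF S.proj_point_subset[OF q]])
qed

lemma hloc_hom_point:
  assumes q: "q \<in> proj_points S"
  shows "(`) (map_prod \<sigma> \<sigma>) \<in> ring_hom (hloc R (\<tau> ` q)) (hloc S q)"
proof -
  interpret sw: graded_iso S R \<tau> \<sigma> by (rule swap)
  show ?thesis
    using hloc_hom[OF sw.proj_point_image[OF q]]
    by (simp add: sw.image_inv_image[OF S.proj_point_subset[OF q]])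
qed

lemma hfrac_point:
  assumes q: "q \<in> proj_points S" and c: "a \<in> carrier R" "b \<in> carrier R"
  shows "map_prod \<sigma> \<sigma> ` hfrac R (\<tau> ` q) a b = hfrac S q (\<sigma> a) (\<sigma> b)"
proof -
  interpret sw: graded_iso S R \<tau> \<sigma> by (rule swap)
  show ?thesis
    using hfrac_image[OF sw.proj_point_image[OF q] c]
    by (simp add: sw.image_inv_image[OF S.proj_point_subset[OF q]])
qed

lemma locally_fraction_comap:
  assumes lf: "locally_fraction R V s"
  shows "locally_fraction S {q \<in> proj_points S. \<tau> ` q \<in> V} (comap (proj_map S \<sigma> \<tau>) V s)"
  unfolding locally_fraction_def
proof
  interpret sw: graded_iso S R \<tau> \<sigma> by (rule swap)
  fix q assume "q \<in> {q \<in> proj_points S. \<tau> ` q \<in> V}"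
  then have q: "q \<in> proj_points S" "\<tau> ` q \<in> V" by auto
  from bspec[OF lf[unfolded locally_fraction_def] q(2)]
  obtain W n a b where W: "openin (zariski R) W" "\<tau> ` q \<in> W" "W \<subseteq> V"
    and ab: "a \<in> gpart R n" "b \<in> gpart R n"
    and s: "\<forall>p\<in>W. b \<notin> p \<and> s p = hfrac R p a b"
    by (elim exE conjE bexE)
  let ?W = "{q \<in> proj_points S. \<tau> ` q \<in> W}"
  have c: "a \<in> carrier R" "b \<in> carrier R" using ab R.gpart_carrier by blast+
  have "\<sigma> b \<notin> q' \<and> comap (proj_map S \<sigma> \<tau>) V s q' = hfrac S q' (\<sigma> a) (\<sigma> b)" if "q' \<in> ?W" for q'
  proof
    show "\<sigma> b \<notin> q'"
      using bspec[OF s, of "\<tau> ` q'"] that imageI[of "\<sigma> b" q' \<tau>] by (auto simp: left_inv[OF c(2)])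
    show "comap (proj_map S \<sigma> \<tau>) V s q' = hfrac S q' (\<sigma> a) (\<sigma> b)"
      using bspec[OF s, of "\<tau> ` q'"] that subsetD[OF W(3), of "\<tau> ` q'"] by (simp add: proj_map_def hfrac_point[OF _ c])
  qed
  then show "\<exists>V'. openin (zariski S) V' \<and> q \<in> V' \<and> V' \<subseteq> {q \<in> proj_points S. \<tau> ` q \<in> V} \<and>
        (\<exists>n. \<exists>a \<in> gpart S n. \<exists>b \<in> gpart S n. \<forall>q' \<in> V'. b \<notin> q' \<and>
           comap (proj_map S \<sigma> \<tau>) V s q' = hfrac S q' a b)"
    using q W(2) subsetD[OF W(3)] gpart_hom[OF ab(1)] gpart_hom[OF ab(2)]
    by (intro exI[of _ ?W] exI[of _ n] conjI bexI[of _ "\<sigma> a"] bexI[of _ "\<sigma> b"]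
          openin_vimage[OF W(1)]) auto
qed

lemma comap_hom:
  "comap (proj_map S \<sigma> \<tau>) V
     \<in> ring_hom (proj_sections R V) (proj_sections S {q \<in> proj_points S. \<tau> ` q \<in> V})"
proof (rule ring_hom_memI)
  fix s assume s: "s \<in> carrier (proj_sections R V)"
  have "map_prod \<sigma> \<sigma> ` s (\<tau> ` q) \<in> carrier (hloc S q)" if "q \<in> proj_points S" "\<tau> ` q \<in> V" for q
    using s that by (intro hloc_closed_point) (auto simp: proj_sections_def)
  then show "comap (proj_map S \<sigma> \<tau>) V s
      \<in> carrier (proj_sections S {q \<in> proj_points S. \<tau> ` q \<in> V})"
    using s locally_fraction_comap[of V s] by (auto simp: proj_sections_def proj_map_def)
next
  fix s t assume st: "s \<in> carrier (proj_sections R V)" "t \<in> carrier (proj_sections R V)"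
  then have *: "s (\<tau> ` q) \<in> carrier (hloc R (\<tau> ` q))" "t (\<tau> ` q) \<in> carrier (hloc R (\<tau> ` q))"
    if "\<tau> ` q \<in> V" for q
    using that by (auto simp: proj_sections_def)
  show "comap (proj_map S \<sigma> \<tau>) V (s \<otimes>\<^bsub>proj_sections R V\<^esub> t)
      = comap (proj_map S \<sigma> \<tau>) V s
          \<otimes>\<^bsub>proj_sections S {q \<in> proj_points S. \<tau> ` q \<in> V}\<^esub> comap (proj_map S \<sigma> \<tau>) V t"
    by (rule ext) (simp add: proj_sections_def proj_map_def * ring_hom_mult[OF hloc_hom_point])
  show "comap (proj_map S \<sigma> \<tau>) V (s \<oplus>\<^bsub>proj_sections R V\<^esub> t)
      = comap (proj_map S \<sigma> \<tau>) V s
          \<oplus>\<^bsub>proj_sections S {q \<in> proj_points S. \<tau> ` q \<in> V}\<^esub> comap (proj_map S \<sigma> \<tau>) V t"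
    by (rule ext) (simp add: proj_sections_def proj_map_def * ring_hom_add[OF hloc_hom_point])
next
  show "comap (proj_map S \<sigma> \<tau>) V \<one>\<^bsub>proj_sections R V\<^esub>
      = \<one>\<^bsub>proj_sections S {q \<in> proj_points S. \<tau> ` q \<in> V}\<^esub>"
    by (rule ext) (simp add: proj_sections_def proj_map_def ring_hom_one[OF hloc_hom_point])
qed

text \<open>The extra restriction to \<open>U\<close> serves two uses: \<open>U = V\<close> shows
  that the comaps invert each other, and a smaller \<open>U\<close> recovers a restriction of
  \<open>s\<close> in the proof of locality.\<close>

lemma comap_inv:
  assumes U: "U \<subseteq> proj_points R" and s: "s \<in> carrier (proj_sections R V)" and "U \<subseteq> V"
  shows "comap (proj_map R \<tau> \<sigma>) {q \<in> proj_points S. \<tau> ` q \<in> U}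
           (restrict (comap (proj_map S \<sigma> \<tau>) V s) {q \<in> proj_points S. \<tau> ` q \<in> U}) = restrict s U"
proof
  fix p
  show "comap (proj_map R \<tau> \<sigma>) {q \<in> proj_points S. \<tau> ` q \<in> U}
      (restrict (comap (proj_map S \<sigma> \<tau>) V s) {q \<in> proj_points S. \<tau> ` q \<in> U}) p = restrict s U p"
  proof (cases "p \<in> proj_points R")
    case True
    then have p: "\<tau> ` \<sigma> ` p = p" "\<sigma> ` p \<in> proj_points S"
      using image_inv_image[OF R.proj_point_subset] proj_point_image by simp_all
    have "s p \<subseteq> carrier R \<times> carrier R" if "p \<in> U"
      using s subsetD[OF \<open>U \<subseteq> V\<close> that]
      by (intro R.hloc_subset) (auto simp: proj_sections_def)
    with True p subsetD[OF \<open>U \<subseteq> V\<close>, of p] show ?thesis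
      by (simp add: proj_map_def map_prod_inv)
  qed (use U in \<open>auto simp: proj_map_def\<close>)
qed

lemma vimage_vimage:
  assumes "U \<subseteq> proj_points R"
  shows "{p \<in> proj_points R. \<sigma> ` p \<in> {q \<in> proj_points S. \<tau> ` q \<in> U}} = U"
proof -
  have "\<sigma> ` p \<in> {q \<in> proj_points S. \<tau> ` q \<in> U} \<longleftrightarrow> p \<in> U" if "p \<in> proj_points R" for p
    using that by (simp add: proj_point_image image_inv_image R.proj_point_subset)
  with assms show ?thesis by blast
qed

section \<open>The induced morphism and its inverse\<close>

lemma is_morphism_proj_map: "is_morphism (Proj S) (Proj R) (proj_map S \<sigma> \<tau>)"
  unfolding is_morphism_def preim_proj_map
proof (intro conjI allI impI ballI)
  interpret sw: graded_iso S R \<tau> \<sigma> by (rule swap)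
  show "continuous_map (top_of (Proj S)) (top_of (Proj R)) (pt (proj_map S \<sigma> \<tau>))"
    using continuous_map_proj by (simp add: Proj_def proj_map_def)
  show "comap (proj_map S \<sigma> \<tau>) V
      \<in> ring_hom (sections (Proj R) V) (sections (Proj S) {q \<in> proj_points S. \<tau> ` q \<in> V})" for V
    using comap_hom by (simp add: Proj_def)
  show "comap (proj_map S \<sigma> \<tau>) W (restr (Proj R) V W s)
      = restr (Proj S) {q \<in> proj_points S. \<tau> ` q \<in> V} {q \<in> proj_points S. \<tau> ` q \<in> W}
          (comap (proj_map S \<sigma> \<tau>) V s)" if "W \<subseteq> V" for V W s
    using that by (auto simp: Proj_def proj_map_def fun_eq_iff restrict_def)
  show "comap (proj_map S \<sigma> \<tau>) (topspace (top_of (Proj R))) (scalar (Proj R) c)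
      = scalar (Proj S) c" for c
    using sw.proj_point_image hfrac_point[OF _ R.const_carrier R.one_closed]
    by (auto simp: Proj_def proj_map_def fun_eq_iff restrict_def R.topspace_zariski
        const_hom ring_hom_one[OF hom])
next
  interpret sw: graded_iso S R \<tau> \<sigma> by (rule swap)
  fix V s q
  let ?V = "{q \<in> proj_points S. \<tau> ` q \<in> V}"
  assume "openin (top_of (Proj R)) V" and s: "s \<in> carrier (sections (Proj R) V)"
    and "q \<in> ?V" and u: "unit_near (Proj S) ?V (comap (proj_map S \<sigma> \<tau>) V s) q"
  then obtain W where W: "openin (zariski S) W" "q \<in> W" "W \<subseteq> ?V"
    and unit: "restrict (comap (proj_map S \<sigma> \<tau>) V s) W \<in> Units (proj_sections S W)"
    by (auto simp: unit_near_def Proj_def)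
  \<comment> \<open>Locality: \<open>U\<close> is the open set of Proj R corresponding to
    \<open>W\<close>. The comap of the inverse morphism is a ring homomorphism, so it turns the unit
    on \<open>W\<close> into a unit on \<open>U\<close>, and by \<open>comap_inv\<close> that unit
    is the restriction of \<open>s\<close>.\<close>
  define U where "U = {p \<in> proj_points R. \<sigma> ` p \<in> W}"
  have sub: "W \<subseteq> proj_points S" using W(1) by (rule S.openin_zariski_subset)
  have W_eq: "W = {q \<in> proj_points S. \<tau> ` q \<in> U}"
    unfolding U_def using sw.vimage_vimage[OF sub] by simp
  have "openin (zariski R) U" unfolding U_def using W(1) by (rule sw.openin_vimage)
  moreover have q: "\<tau> ` q \<in> U" using W(2) W_eq by blast
  moreover have UV: "U \<subseteq> V"
  proof
    fix p assume "p \<in> U"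
    then have "p \<in> proj_points R" "\<sigma> ` p \<in> ?V" using W(3) by (auto simp: U_def)
    then show "p \<in> V" by (simp add: image_inv_image R.proj_point_subset)
  qed
  moreover have "restrict s U \<in> Units (proj_sections R U)"
  proof -
    have "comap (proj_map R \<tau> \<sigma>) W (restrict (comap (proj_map S \<sigma> \<tau>) V s) W)
        \<in> Units (proj_sections R U)"
      using ring_hom_Units[OF sw.comap_hom unit] by (simp add: U_def)
    moreover have "comap (proj_map R \<tau> \<sigma>) W (restrict (comap (proj_map S \<sigma> \<tau>) V s) W)
        = restrict s U"
      unfolding W_eq using s UV by (intro comap_inv) (auto simp: U_def Proj_def)
    ultimately show ?thesis by simp
  qed
  ultimately show "unit_near (Proj R) V s (pt (proj_map S \<sigma> \<tau>) q)"
    by (auto simp: unit_near_def Proj_def proj_map_def)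
qed

lemma same_map_inverse:
  "same_map (Proj R) (Proj R) (comp_map (Proj S) (proj_map S \<sigma> \<tau>) (proj_map R \<tau> \<sigma>)) id_map"
  unfolding same_map_def
proof (intro conjI allI impI ballI)
  fix p assume "p \<in> topspace (top_of (Proj R))"
  then show "pt (comp_map (Proj S) (proj_map S \<sigma> \<tau>) (proj_map R \<tau> \<sigma>)) p = pt id_map p"
    by (simp add: Proj_def R.topspace_zariski comp_map_def id_map_def proj_map_def
        image_inv_image R.proj_point_subset)
next
  fix V s assume "openin (top_of (Proj R)) V" and s: "s \<in> carrier (sections (Proj R) V)"
  then have V: "V \<subseteq> proj_points R"
    using R.openin_zariski_subset by (simp add: Proj_def)
  \<comment> \<open>Comap values and sections are already extensional, so both restrictions in
    \<open>comap_inv\<close> collapse.\<close>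
  have "restrict (comap (proj_map S \<sigma> \<tau>) V s) {q \<in> proj_points S. \<tau> ` q \<in> V}
      = comap (proj_map S \<sigma> \<tau>) V s"
    by (auto simp: proj_map_def)
  moreover have "restrict s V = s"
    using s by (auto simp: Proj_def proj_sections_def PiE_restrict)
  ultimately show "comap (comp_map (Proj S) (proj_map S \<sigma> \<tau>) (proj_map R \<tau> \<sigma>)) V s = comap id_map V s"
    using comap_inv[OF V, of s V] s
    by (simp add: comp_map_def id_map_def preim_proj_map Proj_def[of R])
qed

lemma is_isomorphism_proj_map:
  "is_isomorphism (Proj S) (Proj R) (proj_map S \<sigma> \<tau>)"
proof -
  interpret sw: graded_iso S R \<tau> \<sigma> by (rule swap)
  show ?thesis
    unfolding is_isomorphism_def
    using is_morphism_proj_map sw.is_morphism_proj_map same_map_inverse sw.same_map_inverse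
    by blast
qed

end

section \<open>Quotients by corresponding ideals\<close>

lemma graded_quotient_simps:
  "carrier (graded_quotient R I) = carrier (R Quot I)"
  "mult (graded_quotient R I) = mult (R Quot I)"
  "one (graded_quotient R I) = one (R Quot I)"
  "zero (graded_quotient R I) = zero (R Quot I)"
  "add (graded_quotient R I) = add (R Quot I)"
  "gpart (graded_quotient R I) = (\<lambda>n. (\<lambda>a. I +>\<^bsub>R\<^esub> a) ` gpart R n)"
  "const (graded_quotient R I) = (\<lambda>c. I +>\<^bsub>R\<^esub> const R c)"
  by (simp_all add: graded_quotient_def ring.defs graded_algebra.defs)

text \<open>The two records have different types, but the axioms of \<open>cring\<close>, unfolded
  down to the fields, read only the ring fields, on which the records agree.\<close>

lemma cring_graded_quotient: "cring (graded_quotient R I) \<longleftrightarrow> cring (R Quot I)"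
  unfolding cring_def ring_def abelian_group_def abelian_group_axioms_def abelian_monoid_def
    comm_monoid_def comm_monoid_axioms_def comm_group_def group_def group_axioms_def
    Group.monoid_def ring_axioms_def Units_def
  by (simp add: graded_quotient_simps)

lemma graded_cring_quotient:
  assumes "graded_cring R" and I: "ideal I R"
  shows "graded_cring (graded_quotient R I)"
proof -
  interpret graded_cring R by fact
  interpret ideal I R by fact
  have "I +>\<^bsub>R\<^esub> a \<in> carrier (R Quot I)" if "a \<in> carrier R" for a
    using that rcos_ring_hom by (rule ring_hom_closed[rotated])
  then show ?thesis
    using quotient_is_cring[OF is_cring] gpart_carrier one_gpart const_carrier
    by (intro graded_cring.intro graded_cring_axioms.intro)
      (auto simp: cring_graded_quotient graded_quotient_simps FactRing_def)
qed

text \<open>This makes the image maps of \<open>\<sigma>\<close> and \<open>\<tau>\<close> mutually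
  inverse on cosets.\<close>

lemma carrier_quotient_subset:
  assumes "ideal I R" "X \<in> carrier (graded_quotient R I)"
  shows "X \<subseteq> carrier R"
proof -
  interpret ideal I R by fact
  show ?thesis
    using assms(2) a_subset by (auto simp: graded_quotient_simps FactRing_simps a_r_coset_def')
qed

context graded_iso
begin

lemma image_coset:
  assumes "I \<subseteq> carrier R" "a \<in> carrier R"
  shows "\<sigma> ` (I +>\<^bsub>R\<^esub> a) = \<sigma> ` I +>\<^bsub>S\<^esub> \<sigma> a"
proof -
  have "\<sigma> (h \<oplus>\<^bsub>R\<^esub> a) = \<sigma> h \<oplus>\<^bsub>S\<^esub> \<sigma> a" if "h \<in> I" for h
    using that assms by (auto intro: ring_hom_add[OF hom])
  then show ?thesis by (simp add: a_r_coset_def' image_UN)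
qed

lemma quotient_hom:
  assumes I: "ideal I R"
  shows "(`) \<sigma> \<in> ring_hom (graded_quotient R I) (graded_quotient S (\<sigma> ` I))"
proof -
  interpret I: ideal I R by fact
  interpret J: ideal "\<sigma> ` I" S using I by (rule ideal_image)
  note homI = I.rcos_ring_hom and homJ = J.rcos_ring_hom
  have rep: "\<exists>a\<in>carrier R. X = I +>\<^bsub>R\<^esub> a" if "X \<in> carrier (R Quot I)" for X
    using that by (auto simp: FactRing_simps)
  note coset = image_coset[OF I.a_subset]
  show ?thesis
  proof (rule ring_hom_memI; unfold graded_quotient_simps)
    fix X assume "X \<in> carrier (R Quot I)"
    then show "\<sigma> ` X \<in> carrier (S Quot \<sigma> ` I)"
      using rep[of X] by (auto simp: coset closed ring_hom_closed[OF homJ])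
  next
    fix X Y assume "X \<in> carrier (R Quot I)" "Y \<in> carrier (R Quot I)"
    then obtain a b where ab: "a \<in> carrier R" "b \<in> carrier R" "X = I +>\<^bsub>R\<^esub> a" "Y = I +>\<^bsub>R\<^esub> b"
      using rep by meson
    show "\<sigma> ` (X \<otimes>\<^bsub>R Quot I\<^esub> Y) = \<sigma> ` X \<otimes>\<^bsub>S Quot \<sigma> ` I\<^esub> \<sigma> ` Y"
      by (simp add: ab coset closed ring_hom_mult[OF hom]
          flip: ring_hom_mult[OF homI] ring_hom_mult[OF homJ])
    show "\<sigma> ` (X \<oplus>\<^bsub>R Quot I\<^esub> Y) = \<sigma> ` X \<oplus>\<^bsub>S Quot \<sigma> ` I\<^esub> \<sigma> ` Y"
      by (simp add: ab coset closed ring_hom_add[OF hom]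
          flip: ring_hom_add[OF homI] ring_hom_add[OF homJ])
  next
    show "\<sigma> ` \<one>\<^bsub>R Quot I\<^esub> = \<one>\<^bsub>S Quot \<sigma> ` I\<^esub>"
      by (simp add: coset ring_hom_one[OF hom] flip: ring_hom_one[OF homI] ring_hom_one[OF homJ])
  qed
qed

text \<open>Cosets go to cosets under set image, without choosing representatives. All of the
  preceding theory therefore applies one level up and gives the isomorphism of the closed
  subschemes.\<close>

lemma graded_iso_quotient:
  assumes I: "ideal I R"
  shows "graded_iso (graded_quotient R I) (graded_quotient S (\<sigma> ` I)) ((`) \<sigma>) ((`) \<tau>)"
proof -
  interpret sw: graded_iso S R \<tau> \<sigma> by (rule swap)
  have J: "ideal (\<sigma> ` I) S" using I by (rule ideal_image)
  have sub: "I \<subseteq> carrier R" "\<sigma> ` I \<subseteq> carrier S"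
    using I J by (auto dest: additive_subgroup.a_subset ideal.axioms(1))
  have inv: "\<tau> ` \<sigma> ` I = I" using sub(1) by (rule image_inv_image)
  show ?thesis
  proof (intro graded_iso.intro graded_iso_axioms.intro graded_cring_quotient I J
      R.graded_cring_axioms S.graded_cring_axioms quotient_hom)
    show "(`) \<tau> \<in> ring_hom (graded_quotient S (\<sigma> ` I)) (graded_quotient R I)"
      using sw.quotient_hom[OF J] by (simp add: inv)
    show "\<tau> ` \<sigma> ` X = X" if "X \<in> carrier (graded_quotient R I)" for X
      using carrier_quotient_subset[OF I that] by (rule image_inv_image)
    show "\<sigma> ` \<tau> ` Y = Y" if "Y \<in> carrier (graded_quotient S (\<sigma> ` I))" for Y
      using carrier_quotient_subset[OF J that] by (rule sw.image_inv_image)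
    show "\<sigma> ` X \<in> gpart (graded_quotient S (\<sigma> ` I)) n"
      if "X \<in> gpart (graded_quotient R I) n" for X n
      using that subsetD[OF R.gpart_carrier]
      by (auto simp: graded_quotient_simps image_coset[OF sub(1)] gpart_hom)
    show "\<tau> ` Y \<in> gpart (graded_quotient R I) n"
      if "Y \<in> gpart (graded_quotient S (\<sigma> ` I)) n" for Y n
      using that subsetD[OF S.gpart_carrier]
      by (auto simp: graded_quotient_simps sw.image_coset[OF sub(2)] inv gpart_inv)
    show "\<sigma> ` const (graded_quotient R I) c = const (graded_quotient S (\<sigma> ` I)) c" for c
      by (simp add: graded_quotient_simps image_coset[OF sub(1)] R.const_carrier const_hom)
  qed
qed

section \<open>Compatibility with the closed immersions\<close>

lemma pt_quotient_immersion:
  assumes I: "ideal I R" and q: "q \<in> proj_points (graded_quotient S (\<sigma> ` I))"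
  shows "pt (quotient_immersion R I) ((`) \<tau> ` q) = \<tau> ` pt (quotient_immersion S (\<sigma> ` I)) q"
proof -
  interpret sw: graded_iso S R \<tau> \<sigma> by (rule swap)
  interpret Q: graded_iso "graded_quotient R I" "graded_quotient S (\<sigma> ` I)" "(`) \<sigma>" "(`) \<tau>"
    using I by (rule graded_iso_quotient)
  interpret swQ: graded_iso "graded_quotient S (\<sigma> ` I)" "graded_quotient R I" "(`) \<tau>" "(`) \<sigma>"
    by (rule Q.swap)
  have sub: "I \<subseteq> carrier R" using I by (auto dest: additive_subgroup.a_subset ideal.axioms(1))
  \<comment> \<open>Membership in an image under \<open>\<tau>\<close> is tested by applying
    \<open>\<sigma>\<close>, which moves the coset of \<open>a\<close> to the coset of
    \<open>\<sigma> a\<close>.\<close>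
  have "I +>\<^bsub>R\<^esub> a \<in> (`) \<tau> ` q \<longleftrightarrow> \<sigma> ` I +>\<^bsub>S\<^esub> \<sigma> a \<in> q" if "a \<in> carrier R" for a
    using that ring_hom_closed[OF ideal.rcos_ring_hom[OF I] that]
    by (simp add: swQ.image_eq_vimage[OF Q.S.proj_point_subset[OF q]] graded_quotient_simps
        image_coset[OF sub])
  then have "{a \<in> carrier R. I +>\<^bsub>R\<^esub> a \<in> (`) \<tau> ` q}
      = {a \<in> carrier R. \<sigma> a \<in> {b \<in> carrier S. \<sigma> ` I +>\<^bsub>S\<^esub> b \<in> q}}"
    using closed by auto
  also have "\<dots> = \<tau> ` {b \<in> carrier S. \<sigma> ` I +>\<^bsub>S\<^esub> b \<in> q}"
    by (rule sw.image_eq_vimage[symmetric]) auto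
  finally show ?thesis by (simp add: quotient_immersion_def)
qed

text \<open>Reduction modulo the ideal commutes with \<open>\<sigma>\<close>, by
  \<open>image_coset\<close>. Geometrically, the isomorphism of the subschemes lies over the
  isomorphism of the ambient schemes.\<close>

lemma same_map_quotient:
  assumes I: "ideal I R"
  shows "same_map (Proj (graded_quotient S (\<sigma> ` I))) (Proj R)
           (comp_map (Proj (graded_quotient R I)) (quotient_immersion R I)
              (proj_map (graded_quotient S (\<sigma> ` I)) ((`) \<sigma>) ((`) \<tau>)))
           (comp_map (Proj S) (proj_map S \<sigma> \<tau>) (quotient_immersion S (\<sigma> ` I)))"
    (is "same_map (Proj ?QS) (Proj R) (comp_map (Proj ?QR) ?iR ?h) (comp_map (Proj S) ?f ?iS)")
  unfolding same_map_def
proof (intro conjI allI impI ballI)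
  interpret sw: graded_iso S R \<tau> \<sigma> by (rule swap)
  interpret Q: graded_iso ?QR ?QS "(`) \<sigma>" "(`) \<tau>" using I by (rule graded_iso_quotient)
  interpret swQ: graded_iso ?QS ?QR "(`) \<tau>" "(`) \<sigma>" by (rule Q.swap)
  have sub: "I \<subseteq> carrier R" using I by (auto dest: additive_subgroup.a_subset ideal.axioms(1))
  show "pt (comp_map (Proj ?QR) ?iR ?h) q = pt (comp_map (Proj S) ?f ?iS) q"
    if "q \<in> topspace (top_of (Proj ?QS))" for q
    using that pt_quotient_immersion[OF I, of q]
    by (simp add: Proj_def Q.S.topspace_zariski comp_map_def proj_map_def)
  fix V s
  assume "openin (top_of (Proj R)) V" and s: "s \<in> carrier (sections (Proj R) V)"
  then have V: "V \<subseteq> proj_points R" using R.openin_zariski_subset by (simp add: Proj_def)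
  show "comap (comp_map (Proj ?QR) ?iR ?h) V s = comap (comp_map (Proj S) ?f ?iS) V s"
  proof
    fix q
    let ?P = "pt ?iS q"
    have preim_R: "preim (Proj ?QR) ?iR V = {x \<in> proj_points ?QR. pt ?iR x \<in> V}"
      by (simp add: preim_def Proj_def Q.R.topspace_zariski)
    have comap_iR: "comap ?iR V s x = (\<Union>(a, b)\<in>s (pt ?iR x). hfrac ?QR x (I +>\<^bsub>R\<^esub> a) (I +>\<^bsub>R\<^esub> b))"
      if "x \<in> proj_points ?QR" "pt ?iR x \<in> V" for x
      using that by (simp add: quotient_immersion_def)
    have comap_iS: "comap ?iS U t = (\<lambda>q\<in>{q \<in> proj_points ?QS. pt ?iS q \<in> U}.
        \<Union>(a, b)\<in>t (pt ?iS q). hfrac ?QS q (\<sigma> ` I +>\<^bsub>S\<^esub> a) (\<sigma> ` I +>\<^bsub>S\<^esub> b))" for U t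
      by (simp add: quotient_immersion_def)
    show "comap (comp_map (Proj ?QR) ?iR ?h) V s q = comap (comp_map (Proj S) ?f ?iS) V s q"
    proof (cases "q \<in> proj_points ?QS \<and> \<tau> ` ?P \<in> V")
      case True
      then have q: "q \<in> proj_points ?QS" and PV: "\<tau> ` ?P \<in> V" by auto
      note pt_eq = pt_quotient_immersion[OF I q]
      have q': "(`) \<tau> ` q \<in> proj_points ?QR" using q by (rule swQ.proj_point_image)
      \<comment> \<open>That \<open>?P\<close> is a point of Proj S is read off from its image under
        \<open>\<tau>\<close>, which lies in \<open>V\<close> and so is a point of Proj R.\<close>
      have "?P \<subseteq> carrier S" by (auto simp: quotient_immersion_def)
      then have "\<sigma> ` \<tau> ` ?P = ?P" by (rule sw.image_inv_image)
      with proj_point_image[OF subsetD[OF V PV]] have P: "?P \<in> proj_points S" by simp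
      have sP: "s (\<tau> ` ?P) \<subseteq> carrier R \<times> carrier R"
        using s PV by (intro R.hloc_subset) (auto simp: Proj_def proj_sections_def)
      have frac: "map_prod ((`) \<sigma>) ((`) \<sigma>) ` hfrac ?QR ((`) \<tau> ` q) (I +>\<^bsub>R\<^esub> a) (I +>\<^bsub>R\<^esub> b)
          = hfrac ?QS q (\<sigma> ` I +>\<^bsub>S\<^esub> \<sigma> a) (\<sigma> ` I +>\<^bsub>S\<^esub> \<sigma> b)"
        if "(a, b) \<in> s (\<tau> ` ?P)" for a b
      proof -
        have ab: "a \<in> carrier R" "b \<in> carrier R" using that sP by auto
        then have "I +>\<^bsub>R\<^esub> a \<in> carrier ?QR" "I +>\<^bsub>R\<^esub> b \<in> carrier ?QR"
          by (simp_all add: graded_quotient_simps ring_hom_closed[OF ideal.rcos_ring_hom[OF I]])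
        then show ?thesis
          using Q.hfrac_point[OF q] by (simp add: image_coset[OF sub] ab)
      qed
      have "comap (comp_map (Proj ?QR) ?iR ?h) V s q
          = map_prod ((`) \<sigma>) ((`) \<sigma>) ` comap ?iR V s ((`) \<tau> ` q)"
        using q q' PV by (simp add: comp_map_def proj_map_def preim_R pt_eq)
      also have "\<dots> = (\<Union>(a, b)\<in>s (\<tau> ` ?P). map_prod ((`) \<sigma>) ((`) \<sigma>) ` hfrac ?QR ((`) \<tau> ` q) (I +>\<^bsub>R\<^esub> a) (I +>\<^bsub>R\<^esub> b))"
        using q' PV by (simp add: comap_iR pt_eq image_UN split_beta)
      also have "\<dots> = (\<Union>(a, b)\<in>s (\<tau> ` ?P). hfrac ?QS q (\<sigma> ` I +>\<^bsub>S\<^esub> \<sigma> a) (\<sigma> ` I +>\<^bsub>S\<^esub> \<sigma> b))"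
        by (intro SUP_cong refl) (use frac in \<open>simp add: split_beta\<close>)
      also have "\<dots> = comap (comp_map (Proj S) ?f ?iS) V s q"
        using q P PV by (simp add: comp_map_def preim_proj_map comap_iS split_beta)
          (simp add: proj_map_def split_beta)
      finally show ?thesis .
    next
      case False
      \<comment> \<open>Off the preimage of \<open>V\<close> both comaps are
        \<open>undefined\<close>; \<open>pt_quotient_immersion\<close> shows that the two preimages
        agree.\<close>
      have "comap (comp_map (Proj ?QR) ?iR ?h) V s q = undefined"
        using False pt_quotient_immersion[OF I, of q]
        by (cases "q \<in> proj_points ?QS") (simp_all add: comp_map_def proj_map_def preim_R)
      moreover have "comap (comp_map (Proj S) ?f ?iS) V s q = undefined"
        using False by (auto simp: comp_map_def preim_proj_map comap_iS)
      ultimately show ?thesis by simp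
    qed
  qed
qed

end

text \<open>The isomorphism over Proj R is the \<open>proj_map\<close> of the set images of
  \<open>\<sigma>\<close> and \<open>\<tau>\<close> on cosets.\<close>

lemma same_closed_subscheme_image:
  assumes "graded_iso R R \<sigma> \<tau>" and I: "ideal I R"
  shows "same_closed_subscheme (Proj R)
           (image_subscheme (Proj R) (proj_map R \<sigma> \<tau>) (closed_subscheme_of_ideal R (\<sigma> ` I)))
           (closed_subscheme_of_ideal R I)"
proof -
  interpret graded_iso R R \<sigma> \<tau> by fact
  show ?thesis
    using same_map_quotient[OF I] graded_iso.is_isomorphism_proj_map[OF graded_iso_quotient[OF I]]
    unfolding same_closed_subscheme_def image_subscheme_def closed_subscheme_of_ideal_def by auto
qed

section \<open>Linear substitutions in polynomials\<close>

definition subst :: "('n \<Rightarrow> ('n, 'k) mpoly) \<Rightarrow> ('n::finite, 'k::field) mpoly \<Rightarrow> ('n, 'k) mpoly" where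
  "subst v f = (\<Sum>m\<in>Poly_Mapping.keys f.
     Const (Poly_Mapping.lookup f m) * (\<Prod>i\<in>UNIV. v i ^ Poly_Mapping.lookup m i))"

lemma Const_add: "Const (a + b) = Const a + Const b"
  by (simp add: Const_def single_add)

lemma Const_mult: "Const (a * b) = Const a * Const b"
  by (simp add: Const_def mult_single)

lemma Const_0: "Const 0 = 0"
  by (simp add: Const_def)

lemma Const_1: "Const 1 = 1"
  by (simp add: Const_def)

lemma Const_sum: "Const (\<Sum>i\<in>I. f i) = (\<Sum>i\<in>I. Const (f i))"
  by (induction I rule: infinite_finite_induct) (simp_all add: Const_0 Const_add)

lemma mpoly_sum_singles:
  "f = (\<Sum>m\<in>Poly_Mapping.keys f. Poly_Mapping.single m (Poly_Mapping.lookup f m))"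
  by (rule poly_mapping_eqI)
    (simp add: lookup_sum lookup_single when_def in_keys_iff)

lemma mpoly_induct [case_names single add]:
  fixes f :: "('n, 'k::field) mpoly"
  assumes single: "\<And>m c. P (Poly_Mapping.single m c)"
    and add: "\<And>f g. P f \<Longrightarrow> P g \<Longrightarrow> P (f + g)"
  shows "P f"
proof -
  \<comment> \<open>The instance \<open>single[of 0 0]\<close> is the zero polynomial and covers the
    empty sum as well as an infinite \<open>K\<close>.\<close>
  have "P (\<Sum>m\<in>K. Poly_Mapping.single m (Poly_Mapping.lookup f m))" for K
    by (induction K rule: infinite_finite_induct) (use single[of 0 0] in \<open>simp_all add: single add\<close>)
  then show ?thesis using mpoly_sum_singles[of f] by metis
qed

text \<open>Extra monomials have coefficient 0. A common index set is needed for sums, whose keys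
  may shrink by cancellation.\<close>

lemma subst_superset:
  assumes "finite K" "Poly_Mapping.keys f \<subseteq> K"
  shows "subst v f = (\<Sum>m\<in>K. Const (Poly_Mapping.lookup f m) * (\<Prod>i\<in>UNIV. v i ^ Poly_Mapping.lookup m i))"
  unfolding subst_def using assms
  by (intro sum.mono_neutral_left) (auto simp: in_keys_iff Const_0)

lemma subst_add: "subst v (f + g) = subst v f + subst v g"
  by (simp add: subst_superset[of "Poly_Mapping.keys f \<union> Poly_Mapping.keys g"] keys_add lookup_add
      Const_add distrib_right sum.distrib)

lemma subst_single:
  "subst v (Poly_Mapping.single m c) = Const c * (\<Prod>i\<in>UNIV. v i ^ Poly_Mapping.lookup m i)"
  by (simp add: subst_superset[of "{m}"])

text \<open>Both sides are additive in each factor, so monomials suffice, and there exponents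
  add.\<close>

lemma subst_mult: "subst v (f * g) = subst v f * subst v g"
proof (induction f rule: mpoly_induct)
  case (single m c)
  show ?case
  proof (induction g rule: mpoly_induct)
    case (single n d)
    then show ?case
      by (simp add: mult_single subst_single Const_mult lookup_add power_add prod.distrib mult_ac)
  qed (simp add: subst_add distrib_left)
qed (simp add: subst_add distrib_right)

lemma subst_Const: "subst v (Const c) = Const c"
  by (simp add: Const_def subst_single)

lemma subst_1: "subst v 1 = 1"
  using subst_Const[of v 1] by (simp add: Const_1)

lemma subst_Var: "subst v (Var i) = v i"
proof -
  have "v j ^ Poly_Mapping.lookup (Poly_Mapping.single i 1) j = (if j = i then v j else 1)" for j
    by (simp add: lookup_single when_def)
  then show ?thesis by (simp add: Var_def subst_single Const_1)
qed

lemma subst_sum: "subst v (\<Sum>i\<in>I. f i) = (\<Sum>i\<in>I. subst v (f i))"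
  using subst_Const[of v 0]
  by (induction I rule: infinite_finite_induct) (simp_all add: subst_add Const_0)

lemma subst_prod: "subst v (\<Prod>i\<in>I. f i) = (\<Prod>i\<in>I. subst v (f i))"
  by (induction I rule: infinite_finite_induct) (simp_all add: subst_mult subst_1)

lemma subst_power: "subst v (f ^ n) = subst v f ^ n"
  by (induction n) (simp_all add: subst_mult subst_1)

lemma subst_diff: "subst v (f - g) = subst v f - subst v g"
  using subst_add[of v "f - g" g] by simp

text \<open>The composite is additive and fixes coefficients and variables, hence every monomial,
  which is the product of its powers of variables.\<close>

lemma subst_id:
  assumes "\<And>i. subst w (v i) = Var i"
  shows "subst w (subst v f) = f"
proof -
  have Var_power: "Var i ^ k = Poly_Mapping.single (Poly_Mapping.single i k) 1" for i :: 'a and k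
    by (induction k) (simp_all add: Var_def mult_single flip: single_add)
  have prod: "(\<Prod>i\<in>I. Poly_Mapping.single (g i) (1::'b)) = Poly_Mapping.single (\<Sum>i\<in>I. g i) 1"
    for I and g :: "'a \<Rightarrow> ('a \<Rightarrow>\<^sub>0 nat)"
    by (induction I rule: infinite_finite_induct) (simp_all add: mult_single)
  have monom: "(\<Sum>i\<in>UNIV. Poly_Mapping.single i (Poly_Mapping.lookup m i)) = m" for m :: "'a \<Rightarrow>\<^sub>0 nat"
    by (rule poly_mapping_eqI) (simp add: lookup_sum lookup_single when_def)
  show ?thesis
    by (induction f rule: mpoly_induct)
      (simp_all add: subst_add subst_single subst_mult subst_Const subst_prod subst_power assms
        Var_power prod monom, simp add: Const_def mult_single)
qed

section \<open>Degrees of forms under substitution\<close>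

lemma zero_forms: "0 \<in> forms d"
  by (simp add: forms_def)

lemma forms_add: "f \<in> forms d \<Longrightarrow> g \<in> forms d \<Longrightarrow> f + g \<in> forms d"
  using keys_add[of f g] by (auto simp: forms_def)

lemma forms_sum: "(\<And>i. i \<in> I \<Longrightarrow> f i \<in> forms d) \<Longrightarrow> (\<Sum>i\<in>I. f i) \<in> forms d"
  by (induction I rule: infinite_finite_induct) (auto simp: zero_forms forms_add)

lemma forms_mult:
  assumes "f \<in> forms d" "g \<in> forms e"
  shows "f * g \<in> forms (d + e)"
proof -
  have "(\<Sum>i\<in>UNIV. Poly_Mapping.lookup m i) = d + e" if m: "m \<in> Poly_Mapping.keys (f * g)" for m
  proof -
    obtain a b where "m = a + b" "a \<in> Poly_Mapping.keys f" "b \<in> Poly_Mapping.keys g"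
      using keys_mult[of f g] m by blast
    then show ?thesis using assms by (simp add: forms_def lookup_add sum.distrib)
  qed
  then show ?thesis by (simp add: forms_def)
qed

lemma Const_forms: "Const c \<in> forms 0"
  by (simp add: forms_def Const_def)

lemma one_forms: "1 \<in> forms 0"
  using Const_forms[of 1] by (simp add: Const_1)

lemma Var_forms: "Var i \<in> forms 1"
  by (simp add: forms_def Var_def lookup_single when_def)

lemma forms_power: "f \<in> forms d \<Longrightarrow> f ^ n \<in> forms (n * d)"
  by (induction n) (auto simp: one_forms forms_mult)

lemma forms_prod: "(\<And>i. i \<in> I \<Longrightarrow> f i \<in> forms (d i)) \<Longrightarrow> (\<Prod>i\<in>I. f i) \<in> forms (\<Sum>i\<in>I. d i)"
  by (induction I rule: infinite_finite_induct) (auto simp: one_forms forms_mult)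

lemma subst_forms:
  assumes v: "\<And>i. v i \<in> forms 1" and f: "f \<in> forms d"
  shows "subst v f \<in> forms d"
  unfolding subst_def
proof (rule forms_sum)
  fix m assume "m \<in> Poly_Mapping.keys f"
  then have "(\<Sum>i\<in>UNIV. Poly_Mapping.lookup m i) = d" using f by (simp add: forms_def)
  moreover have "v i ^ Poly_Mapping.lookup m i \<in> forms (Poly_Mapping.lookup m i)" for i
    using forms_power[OF v, of i "Poly_Mapping.lookup m i"] by simp
  ultimately have "(\<Prod>i\<in>UNIV. v i ^ Poly_Mapping.lookup m i) \<in> forms d"
    using forms_prod[of UNIV "\<lambda>i. v i ^ Poly_Mapping.lookup m i" "Poly_Mapping.lookup m"] by simp
  then show "Const (Poly_Mapping.lookup f m) * (\<Prod>i\<in>UNIV. v i ^ Poly_Mapping.lookup m i) \<in> forms d"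
    using forms_mult[OF Const_forms] by fastforce
qed

text \<open>Written with the same expression as the first column of \<open>eigen_matrix\<close>, so
  that its entries fold to linear forms.\<close>

definition linear_form :: "'k::field ^ 'n ^ 'n \<Rightarrow> 'n \<Rightarrow> ('n::finite, 'k) mpoly" where
  "linear_form P i = (const_matrix P *v var_vector) $ i"

lemma linear_form_sum: "linear_form P i = (\<Sum>j\<in>UNIV. Const (P $ i $ j) * Var j)"
  by (simp add: linear_form_def matrix_vector_mult_def const_matrix_def var_vector_def)

lemma linear_form_forms: "linear_form P i \<in> forms 1"
  unfolding linear_form_sum using forms_mult[OF Const_forms Var_forms] by (intro forms_sum) simp

lemma linear_form_mult:
  "linear_form (P ** Q) i = (\<Sum>j\<in>UNIV. Const (P $ i $ j) * linear_form Q j)"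
proof -
  have "linear_form (P ** Q) i
      = (\<Sum>k\<in>UNIV. \<Sum>j\<in>UNIV. Const (P $ i $ j) * (Const (Q $ j $ k) * Var k))"
    by (simp add: linear_form_sum matrix_matrix_mult_def Const_sum Const_mult sum_distrib_right mult.assoc)
  also have "\<dots> = (\<Sum>j\<in>UNIV. Const (P $ i $ j) * linear_form Q j)"
    by (subst sum.swap) (simp add: linear_form_sum sum_distrib_left)
  finally show ?thesis .
qed

lemma linear_form_mat_1: "linear_form (mat 1) i = Var i"
proof -
  have "Const (mat 1 $ i $ j) * Var j = (if j = i then Var j else 0)" for j
    by (simp add: mat_def Const_1 Const_0)
  then have "linear_form (mat 1) i = (\<Sum>j\<in>UNIV. if j = i then Var j else 0)"
    unfolding linear_form_sum by (rule sum.cong[OF refl])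
  then show ?thesis by simp
qed

text \<open>Replacing x by Q x in P x gives P (Q x): matrices multiply in the reverse order of the
  composed substitutions.\<close>

lemma subst_linear_form: "subst (linear_form Q) (linear_form P i) = linear_form (P ** Q) i"
  by (simp add: linear_form_sum[of P] subst_sum subst_mult subst_Const subst_Var linear_form_mult)

text \<open>An injective choice of rows from the two-element type is an ordered pair of distinct
  rows.\<close>

lemma minors2_eigen_matrix:
  "minors2 (eigen_matrix A)
     = {linear_form A a * Var b - Var a * linear_form A b | a b. a \<noteq> b}"
proof -
  have minor: "det (\<chi> k l. eigen_matrix A $ f k $ l)
      = linear_form A (f 1) * Var (f 2) - Var (f 1) * linear_form A (f 2)" for f :: "2 \<Rightarrow> 'a"
    by (simp add: det_2 eigen_matrix_def linear_form_def var_vector_def)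
  show ?thesis
  proof (rule subset_antisym; rule subsetI)
    fix x assume "x \<in> minors2 (eigen_matrix A)"
    then obtain f :: "2 \<Rightarrow> 'a" where "inj f" "x = det (\<chi> k l. eigen_matrix A $ f k $ l)"
      unfolding minors2_def by blast
    moreover have "f 1 \<noteq> f 2" using \<open>inj f\<close> by (simp add: inj_eq)
    ultimately show "x \<in> {linear_form A a * Var b - Var a * linear_form A b | a b. a \<noteq> b}"
      using minor by blast
  next
    fix x assume "x \<in> {linear_form A a * Var b - Var a * linear_form A b | a b. a \<noteq> b}"
    then obtain a b where ab: "a \<noteq> b" "x = linear_form A a * Var b - Var a * linear_form A b"
      by blast
    define f :: "2 \<Rightarrow> 'a" where "f k = (if k = 1 then a else b)" for k
    have "inj f" using ab(1) exhaust_2 by (auto simp: inj_def f_def split: if_splits)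
    moreover have "x = det (\<chi> k l. eigen_matrix A $ f k $ l)"
      unfolding minor by (simp add: f_def ab(2))
    ultimately show "x \<in> minors2 (eigen_matrix A)" unfolding minors2_def by blast
  qed
qed

section \<open>Eigenschemes of similar matrices\<close>

lemma graded_cring_poly_algebra:
  "graded_cring (poly_algebra :: (('n::finite, 'k::field) mpoly, 'k) graded_algebra)"
proof (intro graded_cring.intro graded_cring_axioms.intro cringI abelian_groupI comm_monoidI)
  fix x :: "('n, 'k) mpoly"
  show "\<exists>y\<in>carrier poly_algebra. y \<oplus>\<^bsub>poly_algebra\<^esub> x = \<zero>\<^bsub>poly_algebra\<^esub>"
    by (rule bexI[of _ "- x"]) (simp_all add: poly_algebra_def)
qed (simp_all add: poly_algebra_def algebra_simps one_forms)

lemma graded_iso_subst: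
  assumes "P ** Q = mat 1" "Q ** P = mat 1"
  shows "graded_iso poly_algebra poly_algebra (subst (linear_form P)) (subst (linear_form Q))"
  by (intro graded_iso.intro graded_iso_axioms.intro graded_cring_poly_algebra)
    (simp_all add: poly_algebra_def ring_hom_def subst_mult subst_add subst_1 subst_Const
      subst_forms[OF linear_form_forms] subst_id subst_linear_form linear_form_mat_1 assms)

text \<open>A bridge from the ideal axioms of HOL-Algebra to sums in the type class arithmetic, on
  which \<open>poly_algebra\<close> is built.\<close>

lemma ideal_poly_algebra_sum:
  assumes "ideal I poly_algebra" "\<And>i. i \<in> K \<Longrightarrow> f i \<in> I"
  shows "(\<Sum>i\<in>K. c i * f i) \<in> I"
proof -
  interpret ideal I poly_algebra by fact
  have "c i * f i \<in> I" if "i \<in> K" for i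
    using I_l_closed[of "f i" "c i"] assms(2)[OF that] by (simp add: poly_algebra_def)
  moreover have "0 \<in> I" "\<And>x y. x \<in> I \<Longrightarrow> y \<in> I \<Longrightarrow> x + y \<in> I"
    using additive_subgroup.zero_closed[OF additive_subgroup_axioms]
      additive_subgroup.a_closed[OF additive_subgroup_axioms]
    by (simp_all add: poly_algebra_def)
  ultimately show ?thesis
    by (induction K rule: infinite_finite_induct) auto
qed

text \<open>
  By Cauchy--Binet, the minors of \<open>P (B x | x)\<close> are linear combinations of those of \<open>(B x | x)\<close>.
\<close>

lemma subst_minors2_le:
  fixes A B P :: "'k::field ^ 'n::finite ^ 'n"
  assumes "A ** P = P ** B"
  shows "subst (linear_form P) ` minors2 (eigen_matrix A) \<subseteq> eigen_ideal B"
proof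
  interpret graded_cring "poly_algebra :: (('n, 'k) mpoly, 'k) graded_algebra"
    by (rule graded_cring_poly_algebra)
  have univ: "X \<subseteq> carrier poly_algebra" for X :: "('n, 'k) mpoly set"
    by (simp add: poly_algebra_def)
  have ideal: "ideal (eigen_ideal B) poly_algebra"
    unfolding eigen_ideal_def using univ by (rule genideal_ideal)
  \<comment> \<open>The case \<open>c = d\<close> is included, with value 0, so that the double sum
    below can run over all pairs of rows.\<close>
  have minor: "linear_form B c * Var d - Var c * linear_form B d \<in> eigen_ideal B" for c d
  proof (cases "c = d")
    case True
    then show ?thesis
      using additive_subgroup.zero_closed[OF ideal.axioms(1)[OF ideal]]
      by (simp add: poly_algebra_def mult.commute)
  next
    case False
    then show ?thesis
      using subsetD[OF genideal_self[OF univ, of "minors2 (eigen_matrix B)"]]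
      unfolding eigen_ideal_def minors2_eigen_matrix by blast
  qed
  fix x assume "x \<in> subst (linear_form P) ` minors2 (eigen_matrix A)"
  then obtain a b where
    "x = subst (linear_form P) (linear_form A a * Var b - Var a * linear_form A b)"
    unfolding minors2_eigen_matrix by blast
  \<comment> \<open>The column x is treated as the linear forms of the identity matrix, so that
    \<open>linear_form_mult\<close> expands both columns alike.\<close>
  then have "x = linear_form (P ** B) a * linear_form (P ** mat 1) b
      - linear_form (P ** mat 1) a * linear_form (P ** B) b"
    by (simp add: subst_diff subst_mult subst_Var subst_linear_form assms)
  also have "\<dots> = (\<Sum>c\<in>UNIV. \<Sum>d\<in>UNIV. Const (P $ a $ c) * Const (P $ b $ d) *
      (linear_form B c * Var d - Var c * linear_form B d))"
    unfolding linear_form_mult linear_form_mat_1 sum_product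
    by (simp add: sum_subtractf[symmetric] algebra_simps)
  \<comment> \<open>The factor 1 gives the outer sum the shape of
    \<open>ideal_poly_algebra_sum\<close>.\<close>
  also have "\<dots> = (\<Sum>c\<in>UNIV. 1 * (\<Sum>d\<in>UNIV. Const (P $ a $ c) * Const (P $ b $ d) *
      (linear_form B c * Var d - Var c * linear_form B d)))"
    by simp
  also have "\<dots> \<in> eigen_ideal B"
    by (intro ideal_poly_algebra_sum[OF ideal] minor)
  finally show "x \<in> eigen_ideal B" .
qed

lemma subst_eigen_ideal_le:
  fixes A B P Q :: "'k::field ^ 'n::finite ^ 'n"
  assumes "P ** Q = mat 1" "Q ** P = mat 1" "A ** P = P ** B"
  shows "subst (linear_form P) ` eigen_ideal A \<subseteq> eigen_ideal B"
proof -
  interpret graded_iso poly_algebra poly_algebra "subst (linear_form P)" "subst (linear_form Q)"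
    using assms(1,2) by (rule graded_iso_subst)
  have univ: "X \<subseteq> carrier poly_algebra" for X :: "('n, 'k) mpoly set"
    by (simp add: poly_algebra_def)
  have "subst (linear_form P) ` eigen_ideal A
      = Idl\<^bsub>poly_algebra\<^esub> (subst (linear_form P) ` minors2 (eigen_matrix A))"
    unfolding eigen_ideal_def using univ by (rule Idl_image)
  also have "\<dots> \<subseteq> eigen_ideal B"
    using subst_minors2_le[OF assms(3)] R.genideal_ideal[OF univ]
    by (intro R.genideal_minimal) (auto simp: eigen_ideal_def)
  finally show ?thesis .
qed

lemma subst_eigen_ideal:
  assumes "P ** Q = mat 1" "Q ** P = mat 1" "A ** P = P ** B"
  shows "subst (linear_form P) ` eigen_ideal A = eigen_ideal B"
proof
  show "subst (linear_form P) ` eigen_ideal A \<subseteq> eigen_ideal B"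
    using assms by (rule subst_eigen_ideal_le)
  \<comment> \<open>Multiplying A P = P B by Q on both sides gives B Q = Q A, so the inclusion
    already proved applies with A and B interchanged.\<close>
  have "B ** Q = Q ** (P ** B) ** Q"
    by (simp add: matrix_mul_assoc assms)
  also have "\<dots> = Q ** A ** (P ** Q)"
    by (simp add: matrix_mul_assoc flip: assms(3))
  finally have "B ** Q = Q ** A" by (simp add: assms)
  then have "subst (linear_form Q) ` eigen_ideal B \<subseteq> eigen_ideal A"
    using assms(1,2) by (intro subst_eigen_ideal_le) auto
  then have "subst (linear_form P) ` subst (linear_form Q) ` eigen_ideal B
      \<subseteq> subst (linear_form P) ` eigen_ideal A"
    by (rule image_mono)
  then show "eigen_ideal B \<subseteq> subst (linear_form P) ` eigen_ideal A"
    by (simp add: image_image subst_id subst_linear_form linear_form_mat_1 assms)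
qed

theorem proposition2p5:
  fixes A B :: "'k::field ^ 'n::finite ^ 'n"
  assumes "similar_matrices A B"
  shows "\<exists>\<phi>. is_automorphism (projective_space :: (('n, 'k) mpoly set, _, 'k) ringed_space) \<phi> \<and>
           same_closed_subscheme projective_space
             (image_subscheme projective_space \<phi> (eigenscheme B)) (eigenscheme A)"
proof -
  obtain P where P: "invertible P" and B: "B = matrix_inv P ** A ** P"
    using assms by (auto simp: similar_matrices_def)
  let ?Q = "matrix_inv P"
  \<comment> \<open>\<open>matrix_inv\<close> is a Hilbert choice of a two-sided inverse, so
    invertibility yields both equations.\<close>
  have inv: "P ** ?Q = mat 1" "?Q ** P = mat 1"
    using someI_ex[OF P[unfolded invertible_def]] by (simp_all add: matrix_inv_def)
  have "A ** P = P ** B" by (simp add: B matrix_mul_assoc inv)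
  then have eq: "subst (linear_form P) ` eigen_ideal A = eigen_ideal B"
    using inv by (intro subst_eigen_ideal)
  have iso: "graded_iso poly_algebra poly_algebra (subst (linear_form P)) (subst (linear_form ?Q))"
    using inv by (rule graded_iso_subst)
  interpret graded_cring "poly_algebra :: (('n, 'k) mpoly, 'k) graded_algebra"
    by (rule graded_cring_poly_algebra)
  have "ideal (eigen_ideal A) poly_algebra"
    unfolding eigen_ideal_def by (rule genideal_ideal) (simp add: poly_algebra_def)
  \<comment> \<open>The automorphism is the \<open>proj_map\<close> of the substitution by
    \<open>P\<close>. Its action on points uses the inverse substitution, which takes I_B back to
    I_A.\<close>
  from same_closed_subscheme_image[OF iso this] graded_iso.is_isomorphism_proj_map[OF iso]
  show ?thesis unfolding eq projective_space_def eigenscheme_def by blast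
qed

end
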